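(* The triple $(Dup,Dup,\mathrm{Vect})$, with the infinitesimal biduplicial compatibility relations, is a good triple of operads. That is (over a field $\mathbb K$): the primitive operad of infinitesimal biduplicial bialgebras is $\mathrm{Vect}$, and for any infinitesimal biduplicial bialgebra $\mathcal H$ the following are equivalent: (a) $\mathcal H$ is connected; (b) $\mathcal H$ is isomorphic as a bialgebra to $Dup(\mathrm{Prim}\,\mathcal H)$; (c) $\mathcal H$ is isomorphic as a connected coalgebra to $Dup^c(\mathrm{Prim}\,\mathcal H)$.
   Context: A duplicial algebra ($Dup$-algebra) is a vector space with two binary operations $\prec,\succ$ satisfying $(x\prec y)\prec z=x\prec(y\prec z)$, $(x\succ y)\prec z=x\succ(y\prec z)$, $(x\succ y)\succ z=x\succ(y\succ z)$; $Dup(V)=\bigoplus_{n\ge1}Dup_n\otimes V^{\otimes n}$ is the free one. A $Dup$-coalgebra is a vector space with two cooperations $\delta_\prec,\delta_\succ:C\to C\otimes C$ satisfying the dual relations $(\delta_\prec\otimes\mathrm{id})\delta_\prec=(\mathrm{id}\otimes\delta_\prec)\delta_\prec$, $(\delta_\succ\otimes\mathrm{id})\delta_\prec=(\mathrm{id}\otimes\delta_\prec)\delta_\succ$, $(\delta_\succ\otimes\mathrm{id})\delta_\succ=(\mathrm{id}\otimes\delta_\succ)\delta_\succ$. Write $\delta_\prec(x)=x^\prec_{(1)}\otimes x^\prec_{(2)}$ and $\delta_\succ(x)=x^\succ_{(1)}\otimes x^\succ_{(2)}$ (summation understood). An infinitesimal biduplicial bialgebra ($Dup^c\text{-}Dup$-bialgebra)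 is a vector space that is both a $Dup$-algebra and a $Dup$-coalgebra, with $\delta_\succ(x\succ y)=x\otimes y+x^\succ_{(1)}\otimes(x^\succ_{(2)}\succ y)+(x\succ y^\succ_{(1)})\otimes y^\succ_{(2)}$, $\delta_\prec(x\succ y)=(x\succ y^\prec_{(1)})\otimes y^\prec_{(2)}$, $\delta_\succ(x\prec y)=x^\succ_{(1)}\otimes(x^\succ_{(2)}\prec y)$, $\delta_\prec(x\prec y)=x\otimes y+x^\prec_{(1)}\otimes(x^\prec_{(2)}\prec y)+(x\prec y^\prec_{(1)})\otimes y^\prec_{(2)}$. $Dup(V)$ is such a bialgebra, functorially in $V$, with cooperations vanishing on $V$. $\mathrm{Prim}\,\mathcal H=\ker\delta_\prec\cap\ker\delta_\succ$; $F_r\mathcal H$ is the set of $x$ killed by all iterated cooperations (elements of $Dup_n$ acting $\mathcal H\to\mathcal H^{\otimes n}$) with $n>r$; $\mathcal H$ is connected if $\mathcal H=\bigcup_rF_r\mathcal H$. $Dup^c(V)=\bigoplus_nDup_n^*\otimes V^{\otimes n}$ is the cofree connected $Dup$-coalgebra. $\mathrm{Vect}$ is the identity operad. The primitive operad consists of the operations $\mu\in Dup(n)$ with $\mu(x_1,\dots,x_n)$ primitive in $Dup(\mathbb Kx_1\oplus\cdots\oplus\mathbb Kx_n)$; saying it is $\mathrm{Vect}$ means that it consists of multiples of the identity only, so the enveloping functor $U$ is the free algebra functor. *)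

theory Defs
  imports Complex_Main "HOL-Library.Poly_Mapping" "HOL-Library.Multiset"
begin

section \<open>Formal linear combinations\<close>

abbreviation gen :: "'x \<Rightarrow> 'x \<Rightarrow>\<^sub>0 'k::field" where
  "gen x \<equiv> Poly_Mapping.single x 1"

definition fscale :: "'k::field \<Rightarrow> ('x \<Rightarrow>\<^sub>0 'k) \<Rightarrow> ('x \<Rightarrow>\<^sub>0 'k)" where
  "fscale k p = Poly_Mapping.map ((*) k) p"

definition flin :: "('x \<Rightarrow> ('y \<Rightarrow>\<^sub>0 'k)) \<Rightarrow> ('x \<Rightarrow>\<^sub>0 'k) \<Rightarrow> ('y \<Rightarrow>\<^sub>0 'k::field)" where
  "flin f p = (\<Sum>x\<in>Poly_Mapping.keys p. fscale (Poly_Mapping.lookup p x) (f x))"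

lemma lookup_fscale [simp]: "Poly_Mapping.lookup (fscale k p) x = k * Poly_Mapping.lookup p x"
  unfolding fscale_def by (auto simp: Poly_Mapping.map.rep_eq when_def)

lemma vector_space_fscale: "vector_space (fscale :: 'k::field \<Rightarrow> ('x \<Rightarrow>\<^sub>0 'k) \<Rightarrow> _)"
  by unfold_locales (auto intro!: poly_mapping_eqI simp: lookup_add algebra_simps)

definition concat_prod :: "('x list \<Rightarrow>\<^sub>0 'k) \<Rightarrow> ('x list \<Rightarrow>\<^sub>0 'k) \<Rightarrow> ('x list \<Rightarrow>\<^sub>0 'k::field)" where
  "concat_prod p q = flin (\<lambda>u. flin (\<lambda>v. gen (u @ v)) q) p"

definition pair_prod :: "('x \<Rightarrow>\<^sub>0 'k) \<Rightarrow> ('y \<Rightarrow>\<^sub>0 'k) \<Rightarrow> ('x \<times> 'y \<Rightarrow>\<^sub>0 'k::field)" where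
  "pair_prod p q = flin (\<lambda>x. flin (\<lambda>y. gen (x, y)) q) p"


section \<open>Tensor powers\<close>

text \<open>For a subspace \<open>V\<close> of a vector space, the tensor power of order \<open>n\<close> is the space of formal
  linear combinations of words of length \<open>n\<close> in \<open>V\<close> modulo the span of the multilinearity
  relations; the word \<open>[v1, ..., vn]\<close> stands for the pure tensor of \<open>v1, ..., vn\<close>. Tensors are
  handled through representatives, compared with \<open>tensor_eq\<close>.\<close>

definition tensor_rels ::
  "('k::field \<Rightarrow> 'v::ab_group_add \<Rightarrow> 'v) \<Rightarrow> 'v set \<Rightarrow> nat \<Rightarrow> ('v list \<Rightarrow>\<^sub>0 'k) set" where
  "tensor_rels scale V n =
     {gen (u @ (a + b) # w) - gen (u @ a # w) - gen (u @ b # w) | u w a b.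
        set u \<subseteq> V \<and> set w \<subseteq> V \<and> a \<in> V \<and> b \<in> V \<and> Suc (length u + length w) = n} \<union>
     {gen (u @ scale k a # w) - fscale k (gen (u @ a # w)) | u w k a.
        set u \<subseteq> V \<and> set w \<subseteq> V \<and> a \<in> V \<and> Suc (length u + length w) = n}"

definition tensor_eq ::
  "('k::field \<Rightarrow> 'v::ab_group_add \<Rightarrow> 'v) \<Rightarrow> nat \<Rightarrow> ('v list \<Rightarrow>\<^sub>0 'k) \<Rightarrow> ('v list \<Rightarrow>\<^sub>0 'k) \<Rightarrow> bool" where
  "tensor_eq scale n p q \<longleftrightarrow> p - q \<in> module.span fscale (tensor_rels scale UNIV n)"

text \<open>Word form of an element of the second tensor power written as a combination of pairs.\<close>

abbreviation pair_word :: "('v \<times> 'v \<Rightarrow>\<^sub>0 'k::field) \<Rightarrow> ('v list \<Rightarrow>\<^sub>0 'k)" where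
  "pair_word p \<equiv> flin (\<lambda>(a, b). gen [a, b]) p"


section \<open>Dup-algebras, Dup-coalgebras, infinitesimal biduplicial bialgebras\<close>

locale dup_algebra = vector_space scale
  for scale :: "'k::field \<Rightarrow> 'h::ab_group_add \<Rightarrow> 'h" +
  fixes lt :: "'h \<Rightarrow> 'h \<Rightarrow> 'h" (infixl \<open>\<prec>\<close> 70)
    and gt :: "'h \<Rightarrow> 'h \<Rightarrow> 'h" (infixl \<open>\<succ>\<close> 70)
  assumes lt_linear_left: "Vector_Spaces.linear scale scale (\<lambda>x. x \<prec> y)"
    and lt_linear_right: "Vector_Spaces.linear scale scale (\<lambda>y. x \<prec> y)"
    and gt_linear_left: "Vector_Spaces.linear scale scale (\<lambda>x. x \<succ> y)"
    and gt_linear_right: "Vector_Spaces.linear scale scale (\<lambda>y. x \<succ> y)"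
    and lt_lt: "(x \<prec> y) \<prec> z = x \<prec> (y \<prec> z)"
    and gt_lt: "(x \<succ> y) \<prec> z = x \<succ> (y \<prec> z)"
    and gt_gt: "(x \<succ> y) \<succ> z = x \<succ> (y \<succ> z)"

text \<open>A cooperation is given by a representative \<open>\<delta> x\<close> of its value at each \<open>x\<close>: the pairs in
  the formal sum \<open>\<delta> x\<close> are the Sweedler summands. Linearity and all relations are required
  for the classes only, that is, up to \<open>tensor_eq\<close>.\<close>

locale dup_coalgebra = vector_space scale
  for scale :: "'k::field \<Rightarrow> 'h::ab_group_add \<Rightarrow> 'h" +
  fixes dlt :: "'h \<Rightarrow> ('h \<times> 'h \<Rightarrow>\<^sub>0 'k)"
    and dgt :: "'h \<Rightarrow> ('h \<times> 'h \<Rightarrow>\<^sub>0 'k)"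
  assumes dlt_add: "tensor_eq scale 2 (pair_word (dlt (x + y))) (pair_word (dlt x) + pair_word (dlt y))"
    and dlt_scale: "tensor_eq scale 2 (pair_word (dlt (scale k x))) (fscale k (pair_word (dlt x)))"
    and dgt_add: "tensor_eq scale 2 (pair_word (dgt (x + y))) (pair_word (dgt x) + pair_word (dgt y))"
    and dgt_scale: "tensor_eq scale 2 (pair_word (dgt (scale k x))) (fscale k (pair_word (dgt x)))"
    and dlt_dlt: "tensor_eq scale 3
        (flin (\<lambda>(a, b). flin (\<lambda>(c, d). gen [c, d, b]) (dlt a)) (dlt x))
        (flin (\<lambda>(a, b). flin (\<lambda>(c, d). gen [a, c, d]) (dlt b)) (dlt x))"
    and dgt_dlt: "tensor_eq scale 3
        (flin (\<lambda>(a, b). flin (\<lambda>(c, d). gen [c, d, b]) (dgt a)) (dlt x))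
        (flin (\<lambda>(a, b). flin (\<lambda>(c, d). gen [a, c, d]) (dlt b)) (dgt x))"
    and dgt_dgt: "tensor_eq scale 3
        (flin (\<lambda>(a, b). flin (\<lambda>(c, d). gen [c, d, b]) (dgt a)) (dgt x))
        (flin (\<lambda>(a, b). flin (\<lambda>(c, d). gen [a, c, d]) (dgt b)) (dgt x))"

locale inf_bidup_bialgebra = dup_algebra scale lt gt + dup_coalgebra scale dlt dgt
  for scale :: "'k::field \<Rightarrow> 'h::ab_group_add \<Rightarrow> 'h"
    and lt :: "'h \<Rightarrow> 'h \<Rightarrow> 'h" (infixl \<open>\<prec>\<close> 70)
    and gt :: "'h \<Rightarrow> 'h \<Rightarrow> 'h" (infixl \<open>\<succ>\<close> 70)
    and dlt dgt :: "'h \<Rightarrow> ('h \<times> 'h \<Rightarrow>\<^sub>0 'k)" +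
  assumes dgt_of_gt: "tensor_eq scale 2 (pair_word (dgt (x \<succ> y)))
        (gen [x, y] + flin (\<lambda>(a, b). gen [a, b \<succ> y]) (dgt x) + flin (\<lambda>(a, b). gen [x \<succ> a, b]) (dgt y))"
    and dlt_of_gt: "tensor_eq scale 2 (pair_word (dlt (x \<succ> y)))
        (flin (\<lambda>(a, b). gen [x \<succ> a, b]) (dlt y))"
    and dgt_of_lt: "tensor_eq scale 2 (pair_word (dgt (x \<prec> y)))
        (flin (\<lambda>(a, b). gen [a, b \<prec> y]) (dgt x))"
    and dlt_of_lt: "tensor_eq scale 2 (pair_word (dlt (x \<prec> y)))
        (gen [x, y] + flin (\<lambda>(a, b). gen [a, b \<prec> y]) (dlt x) + flin (\<lambda>(a, b). gen [x \<prec> a, b]) (dlt y))"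


section \<open>The operad Dup\<close>

text \<open>The defining relations equate monomials, so the space of nonsymmetric \<open>n\<close>-ary operations has
  as basis the formal composites with \<open>n\<close> inputs, modulo the congruence generated by the relations.\<close>

datatype dterm = TId | TLt dterm dterm | TGt dterm dterm

primrec inputs :: "dterm \<Rightarrow> nat" where
  "inputs TId = 1"
| "inputs (TLt s t) = inputs s + inputs t"
| "inputs (TGt s t) = inputs s + inputs t"

inductive dup_cong :: "dterm \<Rightarrow> dterm \<Rightarrow> bool" where
  refl: "dup_cong t t"
| sym: "dup_cong s t \<Longrightarrow> dup_cong t s"
| trans: "dup_cong r s \<Longrightarrow> dup_cong s t \<Longrightarrow> dup_cong r t"
| lt_cong: "dup_cong s s' \<Longrightarrow> dup_cong t t' \<Longrightarrow> dup_cong (TLt s t) (TLt s' t')"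
| gt_cong: "dup_cong s s' \<Longrightarrow> dup_cong t t' \<Longrightarrow> dup_cong (TGt s t) (TGt s' t')"
| lt_lt: "dup_cong (TLt (TLt r s) t) (TLt r (TLt s t))"
| gt_lt: "dup_cong (TLt (TGt r s) t) (TGt r (TLt s t))"
| gt_gt: "dup_cong (TGt (TGt r s) t) (TGt r (TGt s t))"

quotient_type dup = dterm / dup_cong
  by (rule equivpI) (auto intro: reflpI sympI transpI dup_cong.refl dup_cong.sym dup_cong.trans)

lift_definition dup_id :: dup is TId .
lift_definition dup_lt :: "dup \<Rightarrow> dup \<Rightarrow> dup" is TLt by (rule dup_cong.lt_cong)
lift_definition dup_gt :: "dup \<Rightarrow> dup \<Rightarrow> dup" is TGt by (rule dup_cong.gt_cong)

lift_definition arity :: "dup \<Rightarrow> nat" is inputs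
proof -
  fix s t assume "dup_cong s t"
  then show "inputs s = inputs t" by induction auto
qed

lemma dup_relations:
  "dup_lt (dup_lt a b) c = dup_lt a (dup_lt b c)"
  "dup_lt (dup_gt a b) c = dup_gt a (dup_lt b c)"
  "dup_gt (dup_gt a b) c = dup_gt a (dup_gt b c)"
  by (transfer; rule dup_cong.lt_lt dup_cong.gt_lt dup_cong.gt_gt)+

lemma dup_induct [case_names id lt gt]:
  assumes "P dup_id" "\<And>a b. P a \<Longrightarrow> P b \<Longrightarrow> P (dup_lt a b)" "\<And>a b. P a \<Longrightarrow> P b \<Longrightarrow> P (dup_gt a b)"
  shows "P c"
  using assms
proof transfer
  fix P and c :: dterm
  assume "P TId" "\<And>a b. P a \<Longrightarrow> P b \<Longrightarrow> P (TLt a b)" "\<And>a b. P a \<Longrightarrow> P b \<Longrightarrow> P (TGt a b)"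
  then show "P c" by (induction c) auto
qed

lemma arity_simps [simp]:
  "arity dup_id = 1"
  "arity (dup_lt a b) = arity a + arity b"
  "arity (dup_gt a b) = arity a + arity b"
  by (transfer; simp)+

lemma arity_pos: "arity c > 0"
  by (induction c rule: dup_induct) auto

lemma dup_cases [case_names id lt gt]:
  obtains "c = dup_id" | a b where "c = dup_lt a b" | a b where "c = dup_gt a b"
proof -
  have "c = dup_id \<or> (\<exists>a b. c = dup_lt a b) \<or> (\<exists>a b. c = dup_gt a b)"
    by (induction c rule: dup_induct) auto
  then show ?thesis using that by blast
qed

lemma finite_arity_le: "finite {c. arity c \<le> n}"
proof (induction n)
  case 0
  have "{c. arity c \<le> 0} = {}"
    using arity_pos by (metis (no_types, lifting) Collect_empty_eq not_le)
  then show ?case by (metis finite.emptyI)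
next
  case (Suc n)
  let ?S = "{c. arity c \<le> n}"
  let ?T = "insert dup_id (case_prod dup_lt ` (?S \<times> ?S) \<union> case_prod dup_gt ` (?S \<times> ?S))"
  have le: "arity a \<le> n \<and> arity b \<le> n" if "arity a + arity b \<le> Suc n" for a b
    using that arity_pos[of a] arity_pos[of b] by linarith
  have "c \<in> ?T" if c: "arity c \<le> Suc n" for c
  proof (cases c rule: dup_cases)
    case (lt a b)
    then have "(a, b) \<in> ?S \<times> ?S" using le c by simp
    then have "case_prod dup_lt (a, b) \<in> case_prod dup_lt ` (?S \<times> ?S)" by (rule imageI)
    then show ?thesis unfolding lt by (simp only: split_conv Un_iff insert_iff) simp
  next
    case (gt a b)
    then have "(a, b) \<in> ?S \<times> ?S" using le c by simp
    then have "case_prod dup_gt (a, b) \<in> case_prod dup_gt ` (?S \<times> ?S)" by (rule imageI)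
    then show ?thesis unfolding gt by (simp only: split_conv Un_iff insert_iff) simp
  next
    case id
    then show ?thesis by blast
  qed
  then have "{c. arity c \<le> Suc n} \<subseteq> ?T" by blast
  moreover have "finite ?T"
    using Suc by (intro finite.insertI finite_UnI finite_imageI finite_cartesian_product)
  ultimately show ?case by (rule finite_subset)
qed

lemma finite_decompositions:
  "finite {(a, b). dup_lt a b = c}" "finite {(a, b). dup_gt a b = c}"
proof -
  let ?S = "{a. arity a \<le> arity c}"
  have "finite (?S \<times> ?S)" by (intro finite_cartesian_product finite_arity_le)
  moreover have "{(a, b). dup_lt a b = c} \<subseteq> ?S \<times> ?S" "{(a, b). dup_gt a b = c} \<subseteq> ?S \<times> ?S"
    by auto
  ultimately show "finite {(a, b). dup_lt a b = c}" "finite {(a, b). dup_gt a b = c}"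
    by (blast intro: finite_subset)+
qed


section \<open>The bialgebra Dup(V) and the coalgebra Dup^c(V)\<close>

text \<open>\<open>(c, [v1, ..., vn])\<close> stands for the tensor of \<open>c\<close> and \<open>v1, ..., vn\<close>, so that
  the direct sum over \<open>n\<close> of the tensor products of the \<open>n\<close>-ary operations with the tensor
  power of order \<open>n\<close> of \<open>V\<close> is \<open>dup_space scale V\<close> modulo \<open>dup_null scale V\<close>.\<close>

type_synonym ('v, 'k) dup_comb = "dup \<times> 'v list \<Rightarrow>\<^sub>0 'k"

definition dup_space :: "'v set \<Rightarrow> ('v, 'k::field) dup_comb set" where
  "dup_space V = {p. \<forall>(c, w) \<in> Poly_Mapping.keys p. length w = arity c \<and> set w \<subseteq> V}"

definition dup_null ::
  "('k::field \<Rightarrow> 'v::ab_group_add \<Rightarrow> 'v) \<Rightarrow> 'v set \<Rightarrow> ('v, 'k) dup_comb set" where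
  "dup_null scale V =
     module.span fscale (\<Union>c. flin (\<lambda>w. gen (c, w)) ` tensor_rels scale V (arity c))"

definition dup_product ::
  "(dup \<Rightarrow> dup \<Rightarrow> dup) \<Rightarrow> ('v, 'k) dup_comb \<Rightarrow> ('v, 'k) dup_comb \<Rightarrow> ('v, 'k::field) dup_comb" where
  "dup_product m p q = flin (\<lambda>(c, u). flin (\<lambda>(d, v). gen (m c d, u @ v)) q) p"

text \<open>The cooperations of the free algebra act on operations only: a word is cut according to the
  arities of the two factors. On operations they are determined by the compatibility relations and
  by vanishing on the identity. The multiset collects the Sweedler summands.\<close>

primrec term_cop_lt :: "dterm \<Rightarrow> (dup \<times> dup) multiset" where
  "term_cop_lt TId = {#}"
| "term_cop_lt (TLt s t) = {#(abs_dup s, abs_dup t)#}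
     + {#(a, dup_lt b (abs_dup t)). (a, b) \<in># term_cop_lt s#}
     + {#(dup_lt (abs_dup s) a, b). (a, b) \<in># term_cop_lt t#}"
| "term_cop_lt (TGt s t) = {#(dup_gt (abs_dup s) a, b). (a, b) \<in># term_cop_lt t#}"

primrec term_cop_gt :: "dterm \<Rightarrow> (dup \<times> dup) multiset" where
  "term_cop_gt TId = {#}"
| "term_cop_gt (TLt s t) = {#(a, dup_lt b (abs_dup t)). (a, b) \<in># term_cop_gt s#}"
| "term_cop_gt (TGt s t) = {#(abs_dup s, abs_dup t)#}
     + {#(a, dup_gt b (abs_dup t)). (a, b) \<in># term_cop_gt s#}
     + {#(dup_gt (abs_dup s) a, b). (a, b) \<in># term_cop_gt t#}"

lemma abs_dup_cong: "dup_cong s t \<Longrightarrow> abs_dup s = abs_dup t"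
  by (simp add: dup.abs_eq_iff)

lemma abs_dup_ops:
  "abs_dup (TLt s t) = dup_lt (abs_dup s) (abs_dup t)"
  "abs_dup (TGt s t) = dup_gt (abs_dup s) (abs_dup t)"
  by (simp_all add: dup_lt.abs_eq dup_gt.abs_eq)

lift_definition cop_lt :: "dup \<Rightarrow> (dup \<times> dup) multiset" is term_cop_lt
proof -
  fix s t assume "dup_cong s t"
  then show "term_cop_lt s = term_cop_lt t"
    by induction
      (auto simp: abs_dup_cong abs_dup_ops dup_relations multiset.map_comp comp_def case_prod_unfold)
qed

lift_definition cop_gt :: "dup \<Rightarrow> (dup \<times> dup) multiset" is term_cop_gt
proof -
  fix s t assume "dup_cong s t"
  then show "term_cop_gt s = term_cop_gt t"
    by induction
      (auto simp: abs_dup_cong abs_dup_ops dup_relations multiset.map_comp comp_def case_prod_unfold)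
qed

lemma cop_lt_simps:
  "cop_lt dup_id = {#}"
  "cop_lt (dup_lt x y) = {#(x, y)#} + {#(a, dup_lt b y). (a, b) \<in># cop_lt x#}
     + {#(dup_lt x a, b). (a, b) \<in># cop_lt y#}"
  "cop_lt (dup_gt x y) = {#(dup_gt x a, b). (a, b) \<in># cop_lt y#}"
  unfolding dup_id_def
  by (induction x rule: dup.abs_induct, induction y rule: dup.abs_induct,
      simp only: abs_dup_ops[symmetric] cop_lt.abs_eq term_cop_lt.simps)+

lemma cop_gt_simps:
  "cop_gt dup_id = {#}"
  "cop_gt (dup_gt x y) = {#(x, y)#} + {#(a, dup_gt b y). (a, b) \<in># cop_gt x#}
     + {#(dup_gt x a, b). (a, b) \<in># cop_gt y#}"
  "cop_gt (dup_lt x y) = {#(a, dup_lt b y). (a, b) \<in># cop_gt x#}"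
  unfolding dup_id_def
  by (induction x rule: dup.abs_induct, induction y rule: dup.abs_induct,
      simp only: abs_dup_ops[symmetric] cop_gt.abs_eq term_cop_gt.simps)+

text \<open>The space of \<open>n\<close>-ary operations is finite dimensional, with basis the \<open>c :: dup\<close> of arity \<open>n\<close>.
  In the cofree coalgebra \<open>(c, w)\<close> stands for the tensor of the dual basis vector of \<open>c\<close> and \<open>w\<close>,
  and the cooperations are the transposes of the composition maps \<open>(a, b) \<mapsto> dup_lt a b\<close> and
  \<open>(a, b) \<mapsto> dup_gt a b\<close>.\<close>

definition cofree_cop_lt :: "dup \<Rightarrow> (dup \<times> dup) multiset" where
  "cofree_cop_lt c = mset_set {(a, b). dup_lt a b = c}"

definition cofree_cop_gt :: "dup \<Rightarrow> (dup \<times> dup) multiset" where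
  "cofree_cop_gt c = mset_set {(a, b). dup_gt a b = c}"

definition word_cop :: "(dup \<Rightarrow> (dup \<times> dup) multiset) \<Rightarrow> ('v, 'k::field) dup_comb
    \<Rightarrow> ((dup \<times> 'v list) \<times> (dup \<times> 'v list) \<Rightarrow>\<^sub>0 'k)" where
  "word_cop cop p = flin (\<lambda>(c, w).
     \<Sum>(a, b) \<in># cop c. gen ((a, take (arity a) w), (b, drop (arity a) w))) p"


section \<open>Primitive elements, connectedness, isomorphisms\<close>

definition prim :: "('k::field \<Rightarrow> 'h::ab_group_add \<Rightarrow> 'h) \<Rightarrow> ('h \<Rightarrow> ('h \<times> 'h \<Rightarrow>\<^sub>0 'k))
    \<Rightarrow> ('h \<Rightarrow> ('h \<times> 'h \<Rightarrow>\<^sub>0 'k)) \<Rightarrow> 'h set" where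
  "prim scale dlt dgt =
     {x. tensor_eq scale 2 (pair_word (dlt x)) 0 \<and> tensor_eq scale 2 (pair_word (dgt x)) 0}"

text \<open>The iterated cooperation attached to a formal composite. These span the action of the \<open>n\<close>-ary
  operations, so it suffices to test them in the definition of the filtration.\<close>

primrec iter_cop :: "('h \<Rightarrow> ('h \<times> 'h \<Rightarrow>\<^sub>0 'k::field)) \<Rightarrow> ('h \<Rightarrow> ('h \<times> 'h \<Rightarrow>\<^sub>0 'k))
    \<Rightarrow> dterm \<Rightarrow> 'h \<Rightarrow> ('h list \<Rightarrow>\<^sub>0 'k)" where
  "iter_cop dlt dgt TId = (\<lambda>x. gen [x])"
| "iter_cop dlt dgt (TLt s t) =
     (\<lambda>x. flin (\<lambda>(a, b). concat_prod (iter_cop dlt dgt s a) (iter_cop dlt dgt t b)) (dlt x))"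
| "iter_cop dlt dgt (TGt s t) =
     (\<lambda>x. flin (\<lambda>(a, b). concat_prod (iter_cop dlt dgt s a) (iter_cop dlt dgt t b)) (dgt x))"

definition filt :: "('k::field \<Rightarrow> 'h::ab_group_add \<Rightarrow> 'h) \<Rightarrow> ('h \<Rightarrow> ('h \<times> 'h \<Rightarrow>\<^sub>0 'k))
    \<Rightarrow> ('h \<Rightarrow> ('h \<times> 'h \<Rightarrow>\<^sub>0 'k)) \<Rightarrow> nat \<Rightarrow> 'h set" where
  "filt scale dlt dgt r =
     {x. \<forall>t. inputs t > r \<longrightarrow> tensor_eq scale (inputs t) (iter_cop dlt dgt t x) 0}"

definition connected_coalgebra :: "('k::field \<Rightarrow> 'h::ab_group_add \<Rightarrow> 'h)
    \<Rightarrow> ('h \<Rightarrow> ('h \<times> 'h \<Rightarrow>\<^sub>0 'k)) \<Rightarrow> ('h \<Rightarrow> ('h \<times> 'h \<Rightarrow>\<^sub>0 'k)) \<Rightarrow> bool" where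
  "connected_coalgebra scale dlt dgt \<longleftrightarrow> (\<Union>r. filt scale dlt dgt r) = UNIV"

text \<open>An isomorphism from the quotient of \<open>dup_space V\<close> by \<open>dup_null scale V\<close> onto the whole space
  \<open>'h\<close> is induced by a linear map on formal combinations; its values outside \<open>dup_space V\<close> are
  irrelevant.\<close>

definition linear_iso_from_dup :: "('k::field \<Rightarrow> 'h::ab_group_add \<Rightarrow> 'h) \<Rightarrow> 'h set
    \<Rightarrow> (('h, 'k) dup_comb \<Rightarrow> 'h) \<Rightarrow> bool" where
  "linear_iso_from_dup scale V \<Phi> \<longleftrightarrow>
     Vector_Spaces.linear fscale scale \<Phi> \<and>
     (\<forall>p \<in> dup_space V. \<forall>q \<in> dup_space V. \<Phi> p = \<Phi> q \<longleftrightarrow> p - q \<in> dup_null scale V) \<and>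
     \<Phi> ` dup_space V = UNIV"

definition preserves_cop :: "('k::field \<Rightarrow> 'h::ab_group_add \<Rightarrow> 'h) \<Rightarrow> 'h set
    \<Rightarrow> (dup \<Rightarrow> (dup \<times> dup) multiset) \<Rightarrow> ('h \<Rightarrow> ('h \<times> 'h \<Rightarrow>\<^sub>0 'k))
    \<Rightarrow> (('h, 'k) dup_comb \<Rightarrow> 'h) \<Rightarrow> bool" where
  "preserves_cop scale V cop \<delta> \<Phi> \<longleftrightarrow>
     (\<forall>p \<in> dup_space V. tensor_eq scale 2
        (pair_word (\<delta> (\<Phi> p))) (flin (\<lambda>(x, y). gen [\<Phi> (gen x), \<Phi> (gen y)]) (word_cop cop p)))"

definition preserves_product :: "'h set \<Rightarrow> (dup \<Rightarrow> dup \<Rightarrow> dup) \<Rightarrow> ('h \<Rightarrow> 'h \<Rightarrow> 'h)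
    \<Rightarrow> (('h, 'k::field) dup_comb \<Rightarrow> 'h) \<Rightarrow> bool" where
  "preserves_product V m m' \<Phi> \<longleftrightarrow>
     (\<forall>p \<in> dup_space V. \<forall>q \<in> dup_space V. \<Phi> (dup_product m p q) = m' (\<Phi> p) (\<Phi> q))"

definition iso_free_bialgebra :: "('k::field \<Rightarrow> 'h::ab_group_add \<Rightarrow> 'h) \<Rightarrow> ('h \<Rightarrow> 'h \<Rightarrow> 'h) \<Rightarrow> ('h \<Rightarrow> 'h \<Rightarrow> 'h)
    \<Rightarrow> ('h \<Rightarrow> ('h \<times> 'h \<Rightarrow>\<^sub>0 'k)) \<Rightarrow> ('h \<Rightarrow> ('h \<times> 'h \<Rightarrow>\<^sub>0 'k)) \<Rightarrow> 'h set \<Rightarrow> bool" where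
  "iso_free_bialgebra scale lt gt dlt dgt V \<longleftrightarrow>
     (\<exists>\<Phi>. linear_iso_from_dup scale V \<Phi> \<and>
        preserves_product V dup_lt lt \<Phi> \<and> preserves_product V dup_gt gt \<Phi> \<and>
        preserves_cop scale V cop_lt dlt \<Phi> \<and> preserves_cop scale V cop_gt dgt \<Phi>)"

definition iso_cofree_coalgebra :: "('k::field \<Rightarrow> 'h::ab_group_add \<Rightarrow> 'h)
    \<Rightarrow> ('h \<Rightarrow> ('h \<times> 'h \<Rightarrow>\<^sub>0 'k)) \<Rightarrow> ('h \<Rightarrow> ('h \<times> 'h \<Rightarrow>\<^sub>0 'k)) \<Rightarrow> 'h set \<Rightarrow> bool" where
  "iso_cofree_coalgebra scale dlt dgt V \<longleftrightarrow>
     (\<exists>\<Phi>. linear_iso_from_dup scale V \<Phi> \<and>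
        preserves_cop scale V cofree_cop_lt dlt \<Phi> \<and> preserves_cop scale V cofree_cop_gt dgt \<Phi>)"


section \<open>The primitive operad\<close>

text \<open>Null combinations in the tensor square of the quotient \<open>dup_space V\<close> by \<open>dup_null scale V\<close>.\<close>

definition dup_square_null :: "('k::field \<Rightarrow> 'v::ab_group_add \<Rightarrow> 'v) \<Rightarrow> 'v set
    \<Rightarrow> ((dup \<times> 'v list) \<times> (dup \<times> 'v list) \<Rightarrow>\<^sub>0 'k) set" where
  "dup_square_null scale V = module.span fscale
     ({pair_prod p q | p q. p \<in> dup_null scale V \<and> q \<in> dup_space V} \<union>
      {pair_prod p q | p q. p \<in> dup_space V \<and> q \<in> dup_null scale V})"

definition dup_prim :: "('k::field \<Rightarrow> 'v::ab_group_add \<Rightarrow> 'v) \<Rightarrow> 'v set \<Rightarrow> ('v, 'k) dup_comb set" where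
  "dup_prim scale V = {p \<in> dup_space V.
     word_cop cop_lt p \<in> dup_square_null scale V \<and> word_cop cop_gt p \<in> dup_square_null scale V}"

text \<open>The symmetric operad: \<open>(c, [\<sigma> 0, ..., \<sigma> (n - 1)])\<close> is the operation sending
  \<open>x0, ..., x(n - 1)\<close> to \<open>c\<close> applied to the permuted arguments.\<close>

definition dup_operad :: "nat \<Rightarrow> (nat, 'k::field) dup_comb set" where
  "dup_operad n = {\<mu>. \<forall>(c, w) \<in> Poly_Mapping.keys \<mu>. arity c = n \<and> mset w = mset [0..<n]}"

definition apply_operation :: "(nat, 'k::field) dup_comb \<Rightarrow> (nat \<Rightarrow> 'v) \<Rightarrow> ('v, 'k) dup_comb" where
  "apply_operation \<mu> x = flin (\<lambda>(c, w). gen (c, map x w)) \<mu>"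

text \<open>The vector space with basis \<open>x0, ..., x(n - 1)\<close>, where \<open>xi\<close> is \<open>gen i\<close>.\<close>

definition span_vars :: "nat \<Rightarrow> (nat \<Rightarrow>\<^sub>0 'k::field) set" where
  "span_vars n = {v. Poly_Mapping.keys v \<subseteq> {..<n}}"

definition prim_operad :: "nat \<Rightarrow> (nat, 'k::field) dup_comb set" where
  "prim_operad n = {\<mu> \<in> dup_operad n. apply_operation \<mu> gen \<in> dup_prim fscale (span_vars n)}"

definition vect_operad :: "nat \<Rightarrow> (nat, 'k::field) dup_comb set" where
  "vect_operad n = (if n = 1 then {fscale k (gen (dup_id, [0])) | k. True} else {0})"

end

(*
  The cooperations of a Dup-coalgebra H turn its linear dual into a Dup-algebra, and tensors over a
  field are determined by their pairings with tensor products of linear functionals. Every statement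
  about cooperations thus becomes one about the pairing between the Dup-algebra of functionals and H.

  In the free algebra the cooperations send an operation c to the sum of all (a, b) with
  c = a < b (respectively c = a > b), each occurring once: they are transposed to the composition
  maps, so the free and the cofree coalgebra have literally the same cooperations. Consequently an
  iterated cooperation c' applied to c(v1, ..., vn) with primitive vi gives v1 (x) ... (x) vn if
  c = c', and 0 if c' has another shape with at least as many inputs. This triangularity gives
  injectivity of Dup(Prim H) -> H. If x lies in F_(r+1) H, its iterated cooperations of arity r + 1
  are tensors of primitive elements, so subtracting the corresponding elements c(v1, ..., v(r+1))
  leaves an element of F_r H; by induction the map is onto when H is connected.
*)
theory Submission
  imports Defs
begin

text \<open>The representatives of the cooperations are constrained only modulo the tensor
  relations, so composites of cooperations are compared through linear functionals. The delicate
  point is the passage between tensors over Prim H and tensors over H: the relations in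
  \<open>dup_null\<close> involve primitive vectors only, while functionals live on all of H. A
  basis of H extending a basis of Prim H settles it in both directions. Its coordinate functionals
  detect tensors over Prim H; this is the injectivity of the map from the tensor powers of Prim H to
  those of H, and it makes the canonical map injective. Coordinates of nonprimitive basis vectors
  vanish on Prim H, so a tensor killed by every product of functionals with a factor vanishing on
  Prim H can be written with primitive letters only; this gives surjectivity. The implications back
  to connectedness start from an arbitrary isomorphism instead of the canonical map; what both
  situations share is isolated as \<open>cut_family\<close>.\<close>

interpretation formal: vector_space "fscale :: 'k::field \<Rightarrow> ('x \<Rightarrow>\<^sub>0 'k) \<Rightarrow> _"
  by (rule vector_space_fscale)

interpretation field: vector_space "(*) :: 'k::field \<Rightarrow> 'k \<Rightarrow> 'k"
  by unfold_locales (auto simp: algebra_simps)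

text \<open>For multiplication as scaling, this rule is oriented against \<open>mult.assoc\<close> and loops with it.\<close>

declare field.scale_scale [simp del]

section \<open>Linear extension\<close>

text \<open>The universal property of formal combinations, with any vector space as target: the
  field yields pairings with functionals, the algebra yields evaluation, and formal combinations
  again yield \<open>flin\<close>.\<close>

definition lext :: "('k::field \<Rightarrow> 'v::ab_group_add \<Rightarrow> 'v) \<Rightarrow> ('x \<Rightarrow> 'v) \<Rightarrow> ('x \<Rightarrow>\<^sub>0 'k) \<Rightarrow> 'v" where
  "lext s \<phi> p = (\<Sum>x\<in>Poly_Mapping.keys p. s (Poly_Mapping.lookup p x) (\<phi> x))"

lemma flin_eq_lext: "flin f p = lext fscale f p"
  by (simp add: flin_def lext_def)

context vector_space
begin

lemma lext_superset:
  assumes "finite A" "Poly_Mapping.keys p \<subseteq> A"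
  shows "lext scale \<phi> p = (\<Sum>x\<in>A. scale (Poly_Mapping.lookup p x) (\<phi> x))"
  unfolding lext_def using assms
  by (intro sum.mono_neutral_left) (auto simp: in_keys_iff)

lemma linear_lext:
  fixes \<phi> :: "'x \<Rightarrow> 'b"
  shows "Vector_Spaces.linear fscale scale (lext scale \<phi>)"
proof (unfold Vector_Spaces.linear_iff, intro conjI allI)
  fix p q :: "'x \<Rightarrow>\<^sub>0 'a" and k
  let ?A = "Poly_Mapping.keys p \<union> Poly_Mapping.keys q"
  have "lext scale \<phi> (p + q) = (\<Sum>x\<in>?A. scale (Poly_Mapping.lookup (p + q) x) (\<phi> x))"
    by (rule lext_superset) (auto simp: in_keys_iff lookup_add)
  also have "\<dots> = lext scale \<phi> p + lext scale \<phi> q"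
    by (simp add: lext_superset[of ?A] lookup_add scale_left_distrib sum.distrib)
  finally show "lext scale \<phi> (p + q) = lext scale \<phi> p + lext scale \<phi> q" .
  have "lext scale \<phi> (fscale k p) =
      (\<Sum>x\<in>Poly_Mapping.keys p. scale (Poly_Mapping.lookup (fscale k p) x) (\<phi> x))"
    by (rule lext_superset) (auto simp: in_keys_iff)
  then show "lext scale \<phi> (fscale k p) = scale k (lext scale \<phi> p)"
    by (simp add: lext_def scale_sum_right)
qed (unfold_locales)

lemmas lext_add = module_hom.add[OF linear_lext[THEN Vector_Spaces.linear.axioms(3)]]
  and lext_diff = module_hom.diff[OF linear_lext[THEN Vector_Spaces.linear.axioms(3)]]
  and lext_fscale = module_hom.scale[OF linear_lext[THEN Vector_Spaces.linear.axioms(3)]]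

lemma lext_zero: "lext scale \<phi> 0 = 0"
  by (simp add: lext_def)

lemma lext_gen: "lext scale \<phi> (gen x) = \<phi> x"
  by (simp add: lext_def)

lemma lext_cong: "(\<And>x. x \<in> Poly_Mapping.keys p \<Longrightarrow> \<phi> x = \<psi> x) \<Longrightarrow> lext scale \<phi> p = lext scale \<psi> p"
  by (simp add: lext_def)

lemma lext_eq_0: "(\<And>x. x \<in> Poly_Mapping.keys p \<Longrightarrow> \<phi> x = 0) \<Longrightarrow> lext scale \<phi> p = 0"
  by (simp add: lext_def)

lemma lext_scale: "lext scale (\<lambda>x. scale k (\<phi> x)) p = scale k (lext scale \<phi> p)"
  by (simp add: lext_def scale_sum_right mult.commute)

lemma lext_sum_mset: "lext scale \<phi> (\<Sum>x\<in>#M. F x) = (\<Sum>x\<in>#M. lext scale \<phi> (F x))"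
  by (induction M) (simp_all add: lext_zero lext_add)

lemma lext_in_subspace:
  assumes "subspace S" "\<And>x. x \<in> Poly_Mapping.keys p \<Longrightarrow> \<phi> x \<in> S"
  shows "lext scale \<phi> p \<in> S"
  unfolding lext_def using assms by (intro subspace_sum subspace_scale) auto

end

lemma linear_of_lext:
  assumes "Vector_Spaces.linear s t F"
  shows "F (lext s \<phi> p) = lext t (\<lambda>x. F (\<phi> x)) p"
proof -
  interpret Vector_Spaces.linear s t F by fact
  show ?thesis by (simp add: lext_def sum scale)
qed

lemma (in vector_space) lext_flin: "lext scale \<phi> (flin f p) = lext scale (\<lambda>x. lext scale \<phi> (f x)) p"
  unfolding flin_eq_lext by (rule linear_of_lext[OF linear_lext])

lemma formal_eq_lext_gen: "p = lext fscale gen p"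
  by (rule poly_mapping_eqI)
    (auto simp: lext_def lookup_sum lookup_single when_def in_keys_iff if_distrib cong: if_cong)

lemma linear_on_formal:
  assumes "Vector_Spaces.linear fscale t F"
  shows "F p = lext t (\<lambda>x. F (gen x)) p"
  by (subst formal_eq_lext_gen) (rule linear_of_lext[OF assms])

lemma lookup_flin: "Poly_Mapping.lookup (flin f p) y = lext (*) (\<lambda>x. Poly_Mapping.lookup (f x) y) p"
  by (simp add: flin_def lext_def lookup_sum)

lemma keys_flin_subset:
  "Poly_Mapping.keys (flin f p) \<subseteq> (\<Union>x\<in>Poly_Mapping.keys p. Poly_Mapping.keys (f x))"
proof
  fix y assume "y \<in> Poly_Mapping.keys (flin f p)"
  then have "lext (*) (\<lambda>x. Poly_Mapping.lookup (f x) y) p \<noteq> 0"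
    by (simp add: in_keys_iff lookup_flin)
  then have "\<exists>x\<in>Poly_Mapping.keys p. Poly_Mapping.lookup (f x) y \<noteq> 0"
    using field.lext_eq_0[of p "\<lambda>x. Poly_Mapping.lookup (f x) y"] by blast
  then show "y \<in> (\<Union>x\<in>Poly_Mapping.keys p. Poly_Mapping.keys (f x))"
    by (simp add: in_keys_iff)
qed

lemma keys_flinE:
  assumes "y \<in> Poly_Mapping.keys (flin f p)"
  obtains x where "x \<in> Poly_Mapping.keys p" "y \<in> Poly_Mapping.keys (f x)"
  using assms keys_flin_subset[of f p] by blast

section \<open>Tensor products of linear functionals\<close>

definition dual :: "('k::field \<Rightarrow> 'v::ab_group_add \<Rightarrow> 'v) \<Rightarrow> ('v \<Rightarrow> 'k) set" where
  "dual s = {f. Vector_Spaces.linear s (*) f}"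

text \<open>A pure tensor of functionals evaluated on a pure tensor of vectors. Since
  \<open>map2\<close> truncates, only lists of equal length are meaningful.\<close>

definition tens :: "('v \<Rightarrow> 'k::field) list \<Rightarrow> 'v list \<Rightarrow> 'k" where
  "tens fs w = prod_list (map2 (\<lambda>f v. f v) fs w)"

lemma tens_simps [simp]:
  "tens [] w = 1" "tens (f # fs) (v # w) = f v * tens fs w"
  by (simp_all add: tens_def)

lemma tens_append:
  "length fs = length u \<Longrightarrow> tens (fs @ gs) (u @ w) = tens fs u * tens gs w"
  by (simp add: tens_def)

lemma tens_split:
  assumes "length fs = length w"
  shows "tens fs w = tens (take n fs) (take n w) * tens (drop n fs) (drop n w)"
  by (metis append_take_drop_id assms length_take tens_append)

context vector_space
begin

lemma dual_iff:
  "f \<in> dual scale \<longleftrightarrow> (\<forall>x y. f (x + y) = f x + f y) \<and> (\<forall>k x. f (scale k x) = k * f x)"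
  unfolding dual_def Vector_Spaces.linear_iff using field.vector_space_axioms vector_space_axioms by auto

lemma dual_zero: "f \<in> dual scale \<Longrightarrow> f 0 = 0"
  by (metis dual_iff add_cancel_left_left)

lemma tens_tensor_rels:
  assumes "r \<in> tensor_rels scale V n" "set fs \<subseteq> dual scale" "length fs = n"
  shows "lext (*) (tens fs) r = 0"
proof -
  have split: "\<exists>fu f fw. fs = fu @ f # fw \<and> length fu = length u \<and> length fw = length w"
    if "Suc (length u + length w) = n" for u w :: "'b list"
  proof (intro exI conjI)
    show "fs = take (length u) fs @ fs ! length u # drop (Suc (length u)) fs"
      using that assms(3) by (intro id_take_nth_drop) simp
  qed (use that assms(3) in auto)
  show ?thesis using assms(1) unfolding tensor_rels_def
  proof (elim UnE CollectE exE conjE)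
    fix u w a b assume r: "r = gen (u @ (a + b) # w) - gen (u @ a # w) - gen (u @ b # w)"
      and "Suc (length u + length w) = n"
    then obtain fu f fw where fs: "fs = fu @ f # fw" "length fu = length u" "length fw = length w"
      using split by blast
    then have "f \<in> dual scale" using assms(2) by auto
    then show ?thesis
      unfolding r field.lext_diff field.lext_gen by (simp add: fs tens_append dual_iff algebra_simps)
  next
    fix u w k a assume r: "r = gen (u @ scale k a # w) - fscale k (gen (u @ a # w))"
      and "Suc (length u + length w) = n"
    then obtain fu f fw where fs: "fs = fu @ f # fw" "length fu = length u" "length fw = length w"
      using split by blast
    then have "f \<in> dual scale" using assms(2) by auto
    then show ?thesis
      unfolding r field.lext_diff field.lext_fscale field.lext_gen
      by (simp add: fs tens_append dual_iff algebra_simps)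
  qed
qed

lemma tens_span_tensor_rels:
  assumes "r \<in> formal.span (tensor_rels scale V n)" "set fs \<subseteq> dual scale" "length fs = n"
  shows "lext (*) (tens fs) r = 0"
  using assms(1)
  by (induction rule: formal.span_induct_alt)
    (auto simp: field.lext_zero field.lext_add field.lext_fscale tens_tensor_rels[OF _ assms(2,3)])

text \<open>Stability under prepending a letter lets words be expanded letter by letter.\<close>

lemma flin_Cons_tensor_rels:
  assumes "r \<in> tensor_rels scale V n" "b \<in> V"
  shows "flin (\<lambda>u. gen (b # u)) r \<in> tensor_rels scale V (Suc n)"
  using assms(1) unfolding tensor_rels_def
proof (elim UnE CollectE exE conjE)
  fix u w x y assume r: "r = gen (u @ (x + y) # w) - gen (u @ x # w) - gen (u @ y # w)"
    and *: "set u \<subseteq> V" "set w \<subseteq> V" "x \<in> V" "y \<in> V" "Suc (length u + length w) = n"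
  show "flin (\<lambda>u. gen (b # u)) r \<in> {gen (u @ (a + b) # w) - gen (u @ a # w) - gen (u @ b # w) | u w a b.
        set u \<subseteq> V \<and> set w \<subseteq> V \<and> a \<in> V \<and> b \<in> V \<and> Suc (length u + length w) = Suc n} \<union>
     {gen (u @ scale k a # w) - fscale k (gen (u @ a # w)) | u w k a.
        set u \<subseteq> V \<and> set w \<subseteq> V \<and> a \<in> V \<and> Suc (length u + length w) = Suc n}"
    using * assms(2)
    by (intro UnI1 CollectI exI[of _ "b # u"] exI[of _ w] exI[of _ x] exI[of _ y])
      (simp add: r flin_eq_lext formal.lext_diff formal.lext_gen)
next
  fix u w k x assume r: "r = gen (u @ scale k x # w) - fscale k (gen (u @ x # w))"
    and *: "set u \<subseteq> V" "set w \<subseteq> V" "x \<in> V" "Suc (length u + length w) = n"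
  show "flin (\<lambda>u. gen (b # u)) r \<in> {gen (u @ (a + b) # w) - gen (u @ a # w) - gen (u @ b # w) | u w a b.
        set u \<subseteq> V \<and> set w \<subseteq> V \<and> a \<in> V \<and> b \<in> V \<and> Suc (length u + length w) = Suc n} \<union>
     {gen (u @ scale k a # w) - fscale k (gen (u @ a # w)) | u w k a.
        set u \<subseteq> V \<and> set w \<subseteq> V \<and> a \<in> V \<and> Suc (length u + length w) = Suc n}"
    using * assms(2)
    by (intro UnI2 CollectI exI[of _ "b # u"] exI[of _ w] exI[of _ x] exI[of _ k])
      (simp add: r flin_eq_lext formal.lext_diff formal.lext_fscale formal.lext_gen)
qed

lemma flin_Cons_span_tensor_rels:
  assumes "r \<in> formal.span (tensor_rels scale V n)" "b \<in> V"
  shows "flin (\<lambda>u. gen (b # u)) r \<in> formal.span (tensor_rels scale V (Suc n))"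
  using assms(1)
  by (induction rule: formal.span_induct_alt)
    (auto simp: flin_eq_lext formal.lext_zero formal.lext_add formal.lext_fscale formal.span_zero
      intro!: formal.span_add formal.span_scale
      intro: formal.span_base[OF flin_Cons_tensor_rels[OF _ assms(2), unfolded flin_eq_lext]])

lemma gen_sum_Cons_tensor_rels:
  assumes "subspace V" "finite S" "S \<subseteq> V" "set w \<subseteq> V"
  shows "gen ((\<Sum>b\<in>S. scale (c b) b) # w) - (\<Sum>b\<in>S. fscale (c b) (gen (b # w)))
    \<in> formal.span (tensor_rels scale V (Suc (length w)))"
  using assms(2,3)
proof (induction S)
  case empty
  \<comment> \<open>The empty combination is the zero vector; its word is null by the scalar
    relation with coefficient 0.\<close>
  have "gen (scale 0 0 # w) - fscale 0 (gen (0 # w)) \<in> tensor_rels scale V (Suc (length w))"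
    unfolding tensor_rels_def using assms(1,4)
    by (intro UnI2 CollectI exI[of _ "[]"] exI[of _ w] exI[of _ 0]) (auto simp: subspace_0)
  then show ?case by (simp add: formal.span_base)
next
  case (insert a S)
  let ?x = "\<Sum>b\<in>S. scale (c b) b"
  have x: "?x \<in> V" using insert.prems assms(1) by (intro subspace_sum subspace_scale) auto
  have a: "a \<in> V" "scale (c a) a \<in> V" using insert.prems assms(1) by (auto intro: subspace_scale)
  have 1: "gen ((scale (c a) a + ?x) # w) - gen (scale (c a) a # w) - gen (?x # w)
      \<in> tensor_rels scale V (Suc (length w))"
    unfolding tensor_rels_def using assms(4) x a
    by (intro UnI1 CollectI exI[of _ "[]"] exI[of _ w] exI[of _ "scale (c a) a"] exI[of _ ?x]) auto
  have 2: "gen (scale (c a) a # w) - fscale (c a) (gen (a # w)) \<in> tensor_rels scale V (Suc (length w))"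
    unfolding tensor_rels_def using assms(4) a
    by (intro UnI2 CollectI exI[of _ "[]"] exI[of _ w] exI[of _ "c a"] exI[of _ a]) auto
  have 3: "gen (?x # w) - (\<Sum>b\<in>S. fscale (c b) (gen (b # w))) \<in> formal.span (tensor_rels scale V (Suc (length w)))"
    using insert by auto
  have telescope: "(p - q - r) + (q - s) + (r - t) = p - (s + t)" for p q r s t :: "'b list \<Rightarrow>\<^sub>0 'a"
    by simp
  show ?case
    using formal.span_add[OF formal.span_add[OF formal.span_base[OF 1] formal.span_base[OF 2]] 3]
    unfolding telescope sum.insert[OF insert.hyps] .
qed

end

section \<open>Coordinates of tensors in a basis adapted to a subspace\<close>

fun expand :: "('v \<Rightarrow> 'v \<Rightarrow> 'k::field) \<Rightarrow> 'v set \<Rightarrow> 'v list \<Rightarrow> ('v list \<Rightarrow>\<^sub>0 'k)" where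
  "expand c S [] = gen []"
| "expand c S (v # w) = (\<Sum>b\<in>S. fscale (c b v) (flin (\<lambda>u. gen (b # u)) (expand c S w)))"

lemma lookup_flin_Cons:
  "Poly_Mapping.lookup (flin (\<lambda>u. gen (b # u)) p) \<beta> =
    (case \<beta> of [] \<Rightarrow> 0 | a # u \<Rightarrow> if a = b then Poly_Mapping.lookup p u else 0)"
  by (auto simp: lookup_flin lext_def lookup_single when_def in_keys_iff if_distrib split: list.split
      cong: if_cong)

text \<open>The coefficients of an expanded tensor are its pairings with products of the coordinate
  functions \<open>c b\<close>, so a tensor killed by all such products expands to zero.\<close>

lemma lookup_expand:
  assumes "finite S"
  shows "Poly_Mapping.lookup (expand c S w) \<beta> =
    (if length \<beta> = length w \<and> set \<beta> \<subseteq> S then tens (map c \<beta>) w else 0)"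
proof (induction w arbitrary: \<beta>)
  case Nil
  then show ?case by (auto simp: lookup_single when_def)
next
  case (Cons v w)
  show ?case
  proof (cases \<beta>)
    case Nil
    then show ?thesis by (simp add: lookup_sum lookup_flin_Cons)
  next
    case (Cons a u)
    have "(\<Sum>b\<in>S. c b v * (if a = b then Poly_Mapping.lookup (expand c S w) u else 0)) =
      (if a \<in> S then c a v * Poly_Mapping.lookup (expand c S w) u else 0)"
      using assms by (simp add: if_distrib cong: if_cong)
    then show ?thesis using Cons.IH[of u] by (simp add: lookup_sum lookup_flin_Cons Cons)
  qed
qed

context vector_space
begin

text \<open>The first letter is expanded by linearity, the others by induction. As \<open>S\<close>
  lies in \<open>V\<close>, only relations between vectors of \<open>V\<close> are used.\<close>

lemma expand_tensor_rels:
  assumes "subspace V" "finite S" "S \<subseteq> V" "set w \<subseteq> V"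
    and "\<And>v. v \<in> set w \<Longrightarrow> v = (\<Sum>b\<in>S. scale (c b v) b)"
  shows "gen w - expand c S w \<in> formal.span (tensor_rels scale V (length w))"
  using assms(4,5)
proof (induction w)
  case Nil
  then show ?case by (simp add: formal.span_zero)
next
  case (Cons v w)
  let ?R = "formal.span (tensor_rels scale V (Suc (length w)))"
  have w: "set w \<subseteq> V" using Cons.prems(1) by simp
  have v: "(\<Sum>b\<in>S. scale (c b v) b) = v"
    by (rule Cons.prems(2)[symmetric]) simp
  have 1: "gen (v # w) - (\<Sum>b\<in>S. fscale (c b v) (gen (b # w))) \<in> ?R"
    using gen_sum_Cons_tensor_rels[OF assms(1-3) w, of "\<lambda>b. c b v"] unfolding v .
  have "gen w - expand c S w \<in> formal.span (tensor_rels scale V (length w))"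
    by (rule Cons.IH[OF w], rule Cons.prems(2)) simp
  then have "(\<Sum>b\<in>S. fscale (c b v) (flin (\<lambda>u. gen (b # u)) (gen w - expand c S w))) \<in> ?R"
    using assms(3) by (intro formal.span_sum formal.span_scale flin_Cons_span_tensor_rels) auto
  then have 2: "(\<Sum>b\<in>S. fscale (c b v) (gen (b # w))) - expand c S (v # w) \<in> ?R"
    by (simp add: flin_eq_lext formal.lext_diff formal.lext_gen formal.scale_right_diff_distrib
        sum_subtractf)
  show ?case using formal.span_add[OF 1 2] by simp
qed

text \<open>A basis of \<open>V\<close> is extended to the whole space. Its coordinate functionals
  are then defined everywhere and restrict on \<open>V\<close> to the coordinates there.\<close>

lemma adapted_basis:
  assumes "subspace V"
  obtains B where "independent B" "span B = UNIV" "span (B \<inter> V) = V"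
proof -
  obtain C where C: "C \<subseteq> V" "independent C" "V \<subseteq> span C"
    using maximal_independent_subset by blast
  show thesis
  proof
    show "independent (extend_basis C)" "span (extend_basis C) = UNIV"
      using C by (simp_all add: independent_extend_basis)
    show "span (extend_basis C \<inter> V) = V"
    proof
      show "span (extend_basis C \<inter> V) \<subseteq> V" using assms by (intro span_minimal) auto
      have "C \<subseteq> extend_basis C \<inter> V" using C extend_basis_superset by blast
      then show "V \<subseteq> span (extend_basis C \<inter> V)" using C(3) span_mono by blast
    qed
  qed
qed

lemma representation_dual:
  assumes "independent B" "span B = UNIV"
  shows "(\<lambda>v. representation B v b) \<in> dual scale"
  using assms by (simp add: dual_iff representation_add representation_scale)

lemma representation_adapted:
  assumes "independent B" "span (B \<inter> V) = V" "v \<in> V"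
  shows "representation B v = representation (B \<inter> V) v"
  using assms by (intro representation_extend) auto

text \<open>Normal form in basis words, in which a word survives only if its coordinate functionals
  do not kill \<open>q\<close>. A general \<open>V\<close> serves to stay inside a subspace;
  \<open>V = UNIV\<close> leaves \<open>B\<close> free to be adapted to some other subspace.\<close>

lemma tensor_expansion:
  assumes B: "independent B" "span B = UNIV" "span (B \<inter> V) = V"
    and q: "\<And>w. w \<in> Poly_Mapping.keys q \<Longrightarrow> length w = n \<and> set w \<subseteq> V"
  obtains p where "q - p \<in> formal.span (tensor_rels scale V n)"
    "\<And>\<beta>. \<beta> \<in> Poly_Mapping.keys p \<Longrightarrow> length \<beta> = n \<and> set \<beta> \<subseteq> B \<inter> V \<and>
      lext (*) (tens (map (\<lambda>b v. representation B v b) \<beta>)) q \<noteq> 0"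
proof -
  define c where "c = (\<lambda>b v. representation B v b)"
  define S where "S = (\<Union>w\<in>Poly_Mapping.keys q. \<Union>v\<in>set w. {b. representation B v b \<noteq> 0})"
  have S: "finite S" unfolding S_def by (intro finite_UN_I finite_keys finite_set finite_representation)
  have SB: "S \<subseteq> B \<inter> V"
  proof
    fix b assume "b \<in> S"
    then obtain w v where "w \<in> Poly_Mapping.keys q" "v \<in> set w" "representation B v b \<noteq> 0"
      unfolding S_def by blast
    then have "representation (B \<inter> V) v b \<noteq> 0"
      using representation_adapted[OF B(1,3)] q by (metis subsetD)
    then show "b \<in> B \<inter> V" by (rule representation_ne_zero)
  qed
  have V: "subspace V" using B(3) subspace_span by metis
  have exp: "gen w - expand c S w \<in> formal.span (tensor_rels scale V n)"
    if w: "w \<in> Poly_Mapping.keys q" for w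
  proof -
    have "v = (\<Sum>b\<in>S. scale (c b v) b)" if v: "v \<in> set w" for v
    proof -
      have "v = (\<Sum>b | representation B v b \<noteq> 0. scale (representation B v b) b)"
        using B by (simp add: sum_nonzero_representation_eq)
      also have "\<dots> = (\<Sum>b\<in>S. scale (c b v) b)"
        unfolding c_def using S v w by (intro sum.mono_neutral_left) (auto simp: S_def)
      finally show ?thesis .
    qed
    moreover have "S \<subseteq> V" "set w \<subseteq> V" "length w = n" using SB q[OF w] by auto
    ultimately show ?thesis using expand_tensor_rels[OF V S, of w c] by metis
  qed
  show thesis
  proof
    have "q - flin (expand c S) q = lext fscale (\<lambda>w. gen w - expand c S w) q"
      using arg_cong[OF formal_eq_lext_gen[of q], of "\<lambda>p. p - flin (expand c S) q"]
      by (simp add: flin_eq_lext lext_def formal.scale_right_diff_distrib sum_subtractf)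
    also have "\<dots> \<in> formal.span (tensor_rels scale V n)"
      using exp by (intro formal.lext_in_subspace formal.subspace_span)
    finally show "q - flin (expand c S) q \<in> formal.span (tensor_rels scale V n)" .
    fix \<beta> assume *: "\<beta> \<in> Poly_Mapping.keys (flin (expand c S) q)"
    then have nz: "lext (*) (\<lambda>w. Poly_Mapping.lookup (expand c S w) \<beta>) q \<noteq> 0"
      by (simp add: in_keys_iff lookup_flin)
    have "\<exists>w\<in>Poly_Mapping.keys q. Poly_Mapping.lookup (expand c S w) \<beta> \<noteq> 0"
      using nz field.lext_eq_0[of q "\<lambda>w. Poly_Mapping.lookup (expand c S w) \<beta>"] by blast
    then have \<beta>: "length \<beta> = n \<and> set \<beta> \<subseteq> S"
      using S q by (auto simp: lookup_expand split: if_splits)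
    have "lext (*) (\<lambda>w. Poly_Mapping.lookup (expand c S w) \<beta>) q = lext (*) (tens (map c \<beta>)) q"
      using S q \<beta> by (intro field.lext_cong) (simp add: lookup_expand)
    then show "length \<beta> = n \<and> set \<beta> \<subseteq> B \<inter> V \<and>
        lext (*) (tens (map (\<lambda>b v. representation B v b) \<beta>)) q \<noteq> 0"
      using \<beta> SB nz by (auto simp: c_def)
  qed
qed

text \<open>Over a field the tensor power of a subspace embeds in that of the whole space: if all
  functionals on the whole space kill \<open>q\<close>, its normal form in an adapted basis is
  empty.\<close>

lemma span_tensor_rels_iff:
  assumes "subspace V"
    and q: "\<And>w. w \<in> Poly_Mapping.keys q \<Longrightarrow> length w = n \<and> set w \<subseteq> V"
  shows "q \<in> formal.span (tensor_rels scale V n) \<longleftrightarrow>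
    (\<forall>fs. set fs \<subseteq> dual scale \<and> length fs = n \<longrightarrow> lext (*) (tens fs) q = 0)" (is "_ \<longleftrightarrow> ?R")
proof
  assume R: ?R
  obtain B where B: "independent B" "span B = UNIV" "span (B \<inter> V) = V"
    using adapted_basis[OF assms(1)] .
  obtain p where p: "q - p \<in> formal.span (tensor_rels scale V n)"
    "\<And>\<beta>. \<beta> \<in> Poly_Mapping.keys p \<Longrightarrow> length \<beta> = n \<and> set \<beta> \<subseteq> B \<inter> V \<and>
      lext (*) (tens (map (\<lambda>b v. representation B v b) \<beta>)) q \<noteq> 0"
    using tensor_expansion[OF B q] by blast
  have "\<beta> \<notin> Poly_Mapping.keys p" for \<beta>
    using p(2)[of \<beta>] R[rule_format, of "map (\<lambda>b v. representation B v b) \<beta>"]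
      representation_dual[OF B(1,2)] by auto
  then have "p = 0" by (simp add: in_keys_iff poly_mapping_eqI)
  then show "q \<in> formal.span (tensor_rels scale V n)" using p(1) by simp
qed (auto intro: tens_span_tensor_rels)

lemma tensor_eqD:
  assumes "tensor_eq scale n p q" "set fs \<subseteq> dual scale" "length fs = n"
  shows "lext (*) (tens fs) p = lext (*) (tens fs) q"
  using tens_span_tensor_rels[OF assms(1)[unfolded tensor_eq_def] assms(2,3)]
  by (simp add: field.lext_diff)

lemma tensor_eq_iff:
  assumes "\<And>w. w \<in> Poly_Mapping.keys p \<Longrightarrow> length w = n" "\<And>w. w \<in> Poly_Mapping.keys q \<Longrightarrow> length w = n"
  shows "tensor_eq scale n p q \<longleftrightarrow>
    (\<forall>fs. set fs \<subseteq> dual scale \<and> length fs = n \<longrightarrow> lext (*) (tens fs) p = lext (*) (tens fs) q)"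
proof -
  have "length w = n \<and> set w \<subseteq> UNIV" if "w \<in> Poly_Mapping.keys (p - q)" for w
    using that assms keys_diff[of p q] by auto
  then show ?thesis
    unfolding tensor_eq_def by (simp add: span_tensor_rels_iff field.lext_diff)
qed

lemma tensor_eq_2_iff:
  assumes "\<And>w. w \<in> Poly_Mapping.keys p \<Longrightarrow> length w = 2" "\<And>w. w \<in> Poly_Mapping.keys q \<Longrightarrow> length w = 2"
  shows "tensor_eq scale 2 p q \<longleftrightarrow>
    (\<forall>f\<in>dual scale. \<forall>g\<in>dual scale. lext (*) (tens [f, g]) p = lext (*) (tens [f, g]) q)"
proof
  assume "tensor_eq scale 2 p q"
  then show "\<forall>f\<in>dual scale. \<forall>g\<in>dual scale. lext (*) (tens [f, g]) p = lext (*) (tens [f, g]) q"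
    by (auto intro!: tensor_eqD)
next
  assume *: "\<forall>f\<in>dual scale. \<forall>g\<in>dual scale. lext (*) (tens [f, g]) p = lext (*) (tens [f, g]) q"
  show "tensor_eq scale 2 p q"
    by (subst tensor_eq_iff) (use assms * in \<open>auto simp: length_Suc_conv numeral_2_eq_2\<close>)
qed

end

section \<open>The dual of a duplicial coalgebra\<close>

text \<open>The convolution product of functionals, transpose of the cooperation. It is computed
  from a representative, but for linear \<open>f\<close> and \<open>g\<close> it depends only on the
  class of \<open>\<delta> x\<close>.\<close>

definition dual_op :: "('h \<Rightarrow> ('h \<times> 'h \<Rightarrow>\<^sub>0 'k::field)) \<Rightarrow> ('h \<Rightarrow> 'k) \<Rightarrow> ('h \<Rightarrow> 'k) \<Rightarrow> 'h \<Rightarrow> 'k" where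
  "dual_op \<delta> f g x = lext (*) (\<lambda>(a, b). f a * g b) (\<delta> x)"

lemma tens_pairs:
  "lext (*) (tens [f, g]) (flin (\<lambda>(a, b). gen [\<phi> a, \<psi> b]) p) = lext (*) (\<lambda>(a, b). f (\<phi> a) * g (\<psi> b)) p"
  by (simp add: field.lext_flin case_prod_unfold field.lext_gen)

lemma keys_pairs:
  "w \<in> Poly_Mapping.keys (flin (\<lambda>(a, b). gen [\<phi> a b, \<psi> a b]) p :: _ \<Rightarrow>\<^sub>0 'k::field) \<Longrightarrow> length w = 2"
  using keys_flin_subset[of "\<lambda>(a, b). gen [\<phi> a b, \<psi> a b] :: _ \<Rightarrow>\<^sub>0 'k" p] by (auto simp: case_prod_unfold)

lemma (in vector_space) pair_word_eq_0_iff: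
  "tensor_eq scale 2 (pair_word p) 0 \<longleftrightarrow>
    (\<forall>f\<in>dual scale. \<forall>g\<in>dual scale. lext (*) (\<lambda>(a, b). f a * g b) p = 0)"
  by (subst tensor_eq_2_iff)
    (auto dest: keys_pairs[where \<phi>="\<lambda>a b. a" and \<psi>="\<lambda>a b. b"] simp: tens_pairs field.lext_zero)

lemma mult_lext: "c * lext (*) \<phi> p = lext (*) (\<lambda>x. c * \<phi> x) p"
  by (simp add: field.lext_scale)

lemma lext_mult: "lext (*) \<phi> p * c = lext (*) (\<lambda>x. \<phi> x * c) p"
  using mult_lext[of c \<phi> p] by (simp add: mult.commute)

context dup_coalgebra
begin

abbreviation dual_lt (infixl "\<triangleleft>" 70) where "f \<triangleleft> g \<equiv> dual_op dlt f g"
abbreviation dual_gt (infixl "\<triangleright>" 70) where "f \<triangleright> g \<equiv> dual_op dgt f g"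

lemma dual_lt_dual:
  assumes "f \<in> dual scale" "g \<in> dual scale"
  shows "f \<triangleleft> g \<in> dual scale"
  unfolding dual_iff
  using tensor_eqD[OF dlt_add, of "[f, g]"] tensor_eqD[OF dlt_scale, of "[f, g]"] assms
  by (auto simp: tens_pairs dual_op_def field.lext_add field.lext_fscale)

lemma dual_gt_dual:
  assumes "f \<in> dual scale" "g \<in> dual scale"
  shows "f \<triangleright> g \<in> dual scale"
  unfolding dual_iff
  using tensor_eqD[OF dgt_add, of "[f, g]"] tensor_eqD[OF dgt_scale, of "[f, g]"] assms
  by (auto simp: tens_pairs dual_op_def field.lext_add field.lext_fscale)

text \<open>The coalgebra relations paired with three functionals, which have to be linear because
  those relations hold only modulo the tensor relations.\<close>

lemma dual_relations:
  assumes "f \<in> dual scale" "g \<in> dual scale" "h \<in> dual scale"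
  shows "(f \<triangleleft> g) \<triangleleft> h = f \<triangleleft> (g \<triangleleft> h)" "(f \<triangleright> g) \<triangleleft> h = f \<triangleright> (g \<triangleleft> h)"
    "(f \<triangleright> g) \<triangleright> h = f \<triangleright> (g \<triangleright> h)"
proof -
  have "((f \<triangleleft> g) \<triangleleft> h) x = (f \<triangleleft> (g \<triangleleft> h)) x" "((f \<triangleright> g) \<triangleleft> h) x = (f \<triangleright> (g \<triangleleft> h)) x"
    "((f \<triangleright> g) \<triangleright> h) x = (f \<triangleright> (g \<triangleright> h)) x" for x
    using tensor_eqD[OF dlt_dlt, of "[f, g, h]" x] tensor_eqD[OF dgt_dlt, of "[f, g, h]" x]
     tensor_eqD[OF dgt_dgt, of "[f, g, h]" x] assms
    by (simp_all add: dual_op_def field.lext_flin field.lext_gen case_prod_unfold mult_lext lext_mult mult.assoc)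
  then show "(f \<triangleleft> g) \<triangleleft> h = f \<triangleleft> (g \<triangleleft> h)" "(f \<triangleright> g) \<triangleleft> h = f \<triangleright> (g \<triangleleft> h)"
    "(f \<triangleright> g) \<triangleright> h = f \<triangleright> (g \<triangleright> h)" by auto
qed

lemma prim_iff:
  "x \<in> prim scale dlt dgt \<longleftrightarrow> (\<forall>f\<in>dual scale. \<forall>g\<in>dual scale. (f \<triangleleft> g) x = 0 \<and> (f \<triangleright> g) x = 0)"
  unfolding prim_def
  by (auto simp: pair_word_eq_0_iff dual_op_def)

lemma subspace_prim: "subspace (prim scale dlt dgt)"
proof (rule subspaceI)
  fix x y k assume "x \<in> prim scale dlt dgt" "y \<in> prim scale dlt dgt"
  then show "x + y \<in> prim scale dlt dgt" "scale k x \<in> prim scale dlt dgt"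
    unfolding prim_iff using dual_lt_dual dual_gt_dual by (auto simp: dual_iff)
qed (auto simp: prim_iff dual_zero dual_lt_dual dual_gt_dual)

end

context inf_bidup_bialgebra
begin

text \<open>The compatibility relations transposed: multiplication by a fixed element acts on
  functionals by precomposition.\<close>

lemma dual_of_products:
  assumes "f \<in> dual scale" "g \<in> dual scale"
  shows "(f \<triangleright> g) (x \<succ> y) = f x * g y + (f \<triangleright> (\<lambda>b. g (b \<succ> y))) x + ((\<lambda>a. f (x \<succ> a)) \<triangleright> g) y"
    "(f \<triangleleft> g) (x \<succ> y) = ((\<lambda>a. f (x \<succ> a)) \<triangleleft> g) y"
    "(f \<triangleright> g) (x \<prec> y) = (f \<triangleright> (\<lambda>b. g (b \<prec> y))) x"
    "(f \<triangleleft> g) (x \<prec> y) = f x * g y + (f \<triangleleft> (\<lambda>b. g (b \<prec> y))) x + ((\<lambda>a. f (x \<prec> a)) \<triangleleft> g) y"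
  using tensor_eqD[OF dgt_of_gt, of "[f, g]"] tensor_eqD[OF dlt_of_gt, of "[f, g]"]
    tensor_eqD[OF dgt_of_lt, of "[f, g]"] tensor_eqD[OF dlt_of_lt, of "[f, g]"] assms
  by (simp_all add: tens_pairs dual_op_def field.lext_add field.lext_gen
      tens_pairs[where \<phi>="\<lambda>x. x"] tens_pairs[where \<psi>="\<lambda>x. x"])

lemma dual_compose:
  assumes "f \<in> dual scale"
  shows "(\<lambda>b. f (b \<prec> y)) \<in> dual scale" "(\<lambda>b. f (b \<succ> y)) \<in> dual scale"
    "(\<lambda>a. f (x \<prec> a)) \<in> dual scale" "(\<lambda>a. f (x \<succ> a)) \<in> dual scale"
  using assms lt_linear_left[of y] gt_linear_left[of y] lt_linear_right[of x] gt_linear_right[of x]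
  unfolding Vector_Spaces.linear_iff dual_iff by auto

end

section \<open>Evaluation of duplicial operations\<close>

primrec term_eval :: "('a \<Rightarrow> 'a \<Rightarrow> 'a) \<Rightarrow> ('a \<Rightarrow> 'a \<Rightarrow> 'a) \<Rightarrow> dterm \<Rightarrow> 'a list \<Rightarrow> 'a" where
  "term_eval l g TId w = hd w"
| "term_eval l g (TLt s t) w = l (term_eval l g s (take (inputs s) w)) (term_eval l g t (drop (inputs s) w))"
| "term_eval l g (TGt s t) w = g (term_eval l g s (take (inputs s) w)) (term_eval l g t (drop (inputs s) w))"

definition dup_eval :: "('a \<Rightarrow> 'a \<Rightarrow> 'a) \<Rightarrow> ('a \<Rightarrow> 'a \<Rightarrow> 'a) \<Rightarrow> dup \<Rightarrow> 'a list \<Rightarrow> 'a" where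
  "dup_eval l g c = term_eval l g (rep_dup c)"

lemma inputs_cong: "dup_cong s t \<Longrightarrow> inputs s = inputs t"
  by (induction rule: dup_cong.induct) auto

lemma arity_abs_dup: "arity (abs_dup t) = inputs t"
  by (rule arity.abs_eq)

lemma abs_rep_dup: "abs_dup (rep_dup c) = c"
  by (rule Quotient3_abs_rep[OF Quotient3_dup])

lemma inputs_rep_dup: "inputs (rep_dup c) = arity c"
  by (metis arity_abs_dup abs_rep_dup)

lemma abs_dup_TId: "abs_dup TId = dup_id"
  by (simp add: dup_id_def)

text \<open>One notion of evaluation serves the algebra and its dual. The carrier \<open>A\<close>
  is there for the dual: the duplicial relations are available for linear functionals, not for all
  functions.\<close>

locale dup_structure =
  fixes A :: "'a set" and l g :: "'a \<Rightarrow> 'a \<Rightarrow> 'a"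
  assumes closed: "x \<in> A \<Longrightarrow> y \<in> A \<Longrightarrow> l x y \<in> A" "x \<in> A \<Longrightarrow> y \<in> A \<Longrightarrow> g x y \<in> A"
    and relations: "x \<in> A \<Longrightarrow> y \<in> A \<Longrightarrow> z \<in> A \<Longrightarrow> l (l x y) z = l x (l y z)"
      "x \<in> A \<Longrightarrow> y \<in> A \<Longrightarrow> z \<in> A \<Longrightarrow> l (g x y) z = g x (l y z)"
      "x \<in> A \<Longrightarrow> y \<in> A \<Longrightarrow> z \<in> A \<Longrightarrow> g (g x y) z = g x (g y z)"
begin

lemma set_take_drop:
  assumes "set w \<subseteq> A" shows "set (take n w) \<subseteq> A" "set (drop n w) \<subseteq> A"
  using assms set_take_subset[of n w] set_drop_subset[of n w] by blast+

lemma term_eval_closed: "set w \<subseteq> A \<Longrightarrow> length w = inputs t \<Longrightarrow> term_eval l g t w \<in> A"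
proof (induction t arbitrary: w)
  case TId
  then show ?case by (cases w) auto
qed (auto intro!: closed simp: set_take_drop)

text \<open>The length condition passes along chains of congruences because \<open>inputs\<close> is
  invariant; in an associativity step both sides cut the word at the same two places.\<close>

lemma term_eval_cong:
  "dup_cong s t \<Longrightarrow> set w \<subseteq> A \<Longrightarrow> length w = inputs s \<Longrightarrow> term_eval l g s w = term_eval l g t w"
proof (induction arbitrary: w rule: dup_cong.induct)
  case (sym s t)
  then show ?case by (simp add: inputs_cong)
next
  case (trans r s t)
  then show ?case by (simp add: inputs_cong)
next
  case (lt_cong s s' t t')
  then have "inputs s' = inputs s" "inputs t' = inputs t" by (simp_all add: inputs_cong)
  with lt_cong show ?case by (simp add: set_take_drop)
next
  case (gt_cong s s' t t')
  then have "inputs s' = inputs s" "inputs t' = inputs t" by (simp_all add: inputs_cong)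
  with gt_cong show ?case by (simp add: set_take_drop)
next
  case (lt_lt r s t)
  then show ?case
    by (auto simp: drop_take add.commute intro!: relations term_eval_closed set_take_drop)
next
  case (gt_lt r s t)
  then show ?case
    by (auto simp: drop_take add.commute intro!: relations term_eval_closed set_take_drop)
next
  case (gt_gt r s t)
  then show ?case
    by (auto simp: drop_take add.commute intro!: relations term_eval_closed set_take_drop)
qed simp

lemma term_eval_eq_dup_eval:
  assumes "set w \<subseteq> A" "length w = inputs t"
  shows "term_eval l g t w = dup_eval l g (abs_dup t) w"
proof -
  have "dup_cong t (rep_dup (abs_dup t))"
    using abs_rep_dup dup.abs_eq_iff by metis
  then show ?thesis unfolding dup_eval_def using assms by (rule term_eval_cong)
qed

lemma dup_eval_closed: "set w \<subseteq> A \<Longrightarrow> length w = arity c \<Longrightarrow> dup_eval l g c w \<in> A"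
  unfolding dup_eval_def by (rule term_eval_closed) (simp_all add: inputs_rep_dup)

lemma dup_eval_id: "x \<in> A \<Longrightarrow> dup_eval l g dup_id [x] = x"
  using term_eval_eq_dup_eval[of "[x]" TId] by (simp add: abs_dup_TId)

lemma dup_eval_lt:
  assumes "set w \<subseteq> A" "length w = arity a + arity b"
  shows "dup_eval l g (dup_lt a b) w = l (dup_eval l g a (take (arity a) w)) (dup_eval l g b (drop (arity a) w))"
proof -
  have "dup_eval l g (abs_dup (TLt (rep_dup a) (rep_dup b))) w = term_eval l g (TLt (rep_dup a) (rep_dup b)) w"
    using assms by (intro term_eval_eq_dup_eval[symmetric]) (simp_all add: inputs_rep_dup)
  then show ?thesis by (simp add: abs_dup_ops abs_rep_dup dup_eval_def inputs_rep_dup)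
qed

lemma dup_eval_gt:
  assumes "set w \<subseteq> A" "length w = arity a + arity b"
  shows "dup_eval l g (dup_gt a b) w = g (dup_eval l g a (take (arity a) w)) (dup_eval l g b (drop (arity a) w))"
proof -
  have "dup_eval l g (abs_dup (TGt (rep_dup a) (rep_dup b))) w = term_eval l g (TGt (rep_dup a) (rep_dup b)) w"
    using assms by (intro term_eval_eq_dup_eval[symmetric]) (simp_all add: inputs_rep_dup)
  then show ?thesis by (simp add: abs_dup_ops abs_rep_dup dup_eval_def inputs_rep_dup)
qed

lemma dup_eval_lt_append:
  assumes "set u \<subseteq> A" "set w \<subseteq> A" "length u = arity a" "length w = arity b"
  shows "dup_eval l g (dup_lt a b) (u @ w) = l (dup_eval l g a u) (dup_eval l g b w)"
  using assms by (simp add: dup_eval_lt)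

lemma dup_eval_gt_append:
  assumes "set u \<subseteq> A" "set w \<subseteq> A" "length u = arity a" "length w = arity b"
  shows "dup_eval l g (dup_gt a b) (u @ w) = g (dup_eval l g a u) (dup_eval l g b w)"
  using assms by (simp add: dup_eval_gt)

end

sublocale dup_algebra \<subseteq> algebra: dup_structure UNIV lt gt
  by unfold_locales (simp_all add: lt_lt gt_lt gt_gt)

sublocale dup_coalgebra \<subseteq> dual: dup_structure "dual scale" "dual_op dlt" "dual_op dgt"
  by unfold_locales (simp_all add: dual_lt_dual dual_gt_dual dual_relations)

section \<open>The cooperations of the free and of the cofree coalgebra coincide\<close>

text \<open>Gluing the two parts of a summand together again gives \<open>c\<close> by a duplicial
  relation, for instance \<open>dup_lt a (dup_lt b y) = dup_lt (dup_lt a b) y\<close>.\<close>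

lemma cop_lt_imp: "(a, b) \<in># cop_lt c \<Longrightarrow> dup_lt a b = c"
proof (induction c arbitrary: a b rule: dup_induct)
  case (lt x y)
  from lt.prems show ?case by (auto simp: cop_lt_simps; metis lt.IH dup_relations)
next
  case (gt x y)
  from gt.prems show ?case by (auto simp: cop_lt_simps; metis gt.IH dup_relations)
qed (simp add: cop_lt_simps)

text \<open>Since \<open>cop_lt\<close> is defined on congruence classes, its recursion may be
  applied to any decomposition \<open>dup_lt a b\<close> of \<open>c\<close>, and it then lists
  \<open>(a, b)\<close> itself.\<close>

lemma cop_lt_iff: "(a, b) \<in># cop_lt c \<longleftrightarrow> dup_lt a b = c"
  using cop_lt_imp by (auto simp: cop_lt_simps)

lemma cop_gt_imp: "(a, b) \<in># cop_gt c \<Longrightarrow> dup_gt a b = c"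
proof (induction c arbitrary: a b rule: dup_induct)
  case (lt x y)
  from lt.prems show ?case by (auto simp: cop_gt_simps; metis lt.IH dup_relations)
next
  case (gt x y)
  from gt.prems show ?case by (auto simp: cop_gt_simps; metis gt.IH dup_relations)
qed (simp add: cop_gt_simps)

lemma cop_gt_iff: "(a, b) \<in># cop_gt c \<longleftrightarrow> dup_gt a b = c"
  using cop_gt_imp by (auto simp: cop_gt_simps)

section \<open>Multiplicity one of the cuts\<close>

lemma count_image_plus:
  "count (image_mset ((+) k) M) n = (if k \<le> n then count M (n - k) else (0::nat))" for k n :: nat
  by (induction M) auto

lemma arity_fst_single: "image_mset (arity \<circ> fst) {#(a, b)#} = {#arity a#}"
  by simp

lemma arity_fst_cop:
  "image_mset (arity \<circ> fst) {#(a, F b). (a, b) \<in># M#} = image_mset (arity \<circ> fst) M"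
  by (simp add: multiset.map_comp comp_def case_prod_unfold)

lemma arity_fst_shift_cop:
  assumes "\<And>a. arity (F a) = k + arity a"
  shows "image_mset (arity \<circ> fst) {#(F a, b). (a, b) \<in># M#} = image_mset ((+) k) (image_mset (arity \<circ> fst) M)"
  using assms by (simp add: multiset.map_comp comp_def case_prod_unfold)

text \<open>The cuts of an operation in two are told apart by the number of inputs of the first part.\<close>

lemma count_cut_arities:
  assumes A: "\<And>n. count A n \<le> 1" "\<And>n. n \<in># A \<Longrightarrow> n < k"
    and B: "\<And>n. count B n \<le> 1" "\<And>n. n \<in># B \<Longrightarrow> 0 < n"
  shows "count ({#k#} + A + image_mset ((+) k) B) (n::nat) \<le> 1"
proof -
  have "count A n = 0" if "k \<le> n" using that A(2)[of n] by (auto simp: not_in_iff[symmetric])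
  moreover have "count B 0 = 0" using B(2)[of 0] by (auto simp: not_in_iff[symmetric])
  ultimately show ?thesis using A(1)[of n] B(1)[of "n - k"]
    by (cases n k rule: linorder_cases) (auto simp: count_image_plus)
qed

text \<open>In \<open>dup_lt x y\<close>, the first parts of the cuts inside \<open>x\<close>,
  between \<open>x\<close> and \<open>y\<close>, and inside \<open>y\<close> have arity below, equal
  to and above \<open>arity x\<close>. In \<open>dup_gt x y\<close> only the cuts inside
  \<open>y\<close> remain, shifted by \<open>arity x\<close>.\<close>

lemma cop_lt_arities: "count (image_mset (arity \<circ> fst) (cop_lt c)) n \<le> 1"
proof (induction c arbitrary: n rule: dup_induct)
  case (lt x y)
  show ?case unfolding cop_lt_simps image_mset_union arity_fst_single arity_fst_cop
      arity_fst_shift_cop[of "dup_lt x" "arity x", OF arity_simps(2)]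
    by (intro count_cut_arities lt.IH) (use arity_pos in \<open>auto simp: cop_lt_iff\<close>)
next
  case (gt x y)
  show ?case unfolding cop_lt_simps arity_fst_shift_cop[of "dup_gt x" "arity x", OF arity_simps(3)]
      count_image_plus using gt.IH(2) by (simp add: comp_def)
qed (simp add: cop_lt_simps)

lemma cop_gt_arities: "count (image_mset (arity \<circ> fst) (cop_gt c)) n \<le> 1"
proof (induction c arbitrary: n rule: dup_induct)
  case (gt x y)
  show ?case unfolding cop_gt_simps image_mset_union arity_fst_single arity_fst_cop
      arity_fst_shift_cop[of "dup_gt x" "arity x", OF arity_simps(3)]
    by (intro count_cut_arities gt.IH) (use arity_pos in \<open>auto simp: cop_gt_iff\<close>)
next
  case (lt x y)
  show ?case unfolding cop_gt_simps arity_fst_cop by (rule lt.IH(1))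
qed (simp add: cop_gt_simps)

text \<open>A multiplicity never exceeds that of the image, so \<open>M\<close> has no repetitions
  and is determined by its support.\<close>

lemma mset_set_of_distinct_image:
  assumes "\<And>n. count (image_mset f M) n \<le> 1"
  shows "M = mset_set (set_mset M)"
proof (rule multiset_eqI)
  fix x
  have "count M x \<le> count (image_mset f M) (f x)"
    by (induction M) auto
  then have "count M x \<le> 1" using assms le_trans by blast
  moreover have "x \<in># M \<longleftrightarrow> 1 \<le> count M x" by (simp add: Suc_le_eq)
  ultimately have "count M x = (if x \<in># M then 1 else 0)" by (metis le_antisym not_in_iff)
  then show "count M x = count (mset_set (set_mset M)) x" by simp
qed

text \<open>Same support and multiplicity one on both sides. Through this identity conditions (b)
  and (c) speak of the same cooperations.\<close>

lemma cop_lt_eq_cofree: "cop_lt = cofree_cop_lt"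
proof
  fix c
  have "set_mset (cop_lt c) = {(a, b). dup_lt a b = c}" by (auto simp: cop_lt_iff)
  then show "cop_lt c = cofree_cop_lt c"
    using mset_set_of_distinct_image[OF cop_lt_arities, of c] by (simp add: cofree_cop_lt_def)
qed

lemma cop_gt_eq_cofree: "cop_gt = cofree_cop_gt"
proof
  fix c
  have "set_mset (cop_gt c) = {(a, b). dup_gt a b = c}" by (auto simp: cop_gt_iff)
  then show "cop_gt c = cofree_cop_gt c"
    using mset_set_of_distinct_image[OF cop_gt_arities, of c] by (simp add: cofree_cop_gt_def)
qed

section \<open>Iterated cooperations and the connectivity filtration\<close>

lemma keys_concat_prod:
  assumes "\<And>u. u \<in> Poly_Mapping.keys p \<Longrightarrow> length u = m" "\<And>v. v \<in> Poly_Mapping.keys q \<Longrightarrow> length v = n"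
    and "w \<in> Poly_Mapping.keys (concat_prod p q)"
  shows "length w = m + n"
proof -
  from assms(3) obtain u where u: "u \<in> Poly_Mapping.keys p"
    "w \<in> Poly_Mapping.keys (flin (\<lambda>v. gen (u @ v) :: 'a list \<Rightarrow>\<^sub>0 'b) q)"
    unfolding concat_prod_def by (rule keys_flinE)
  from u(2) obtain v where "v \<in> Poly_Mapping.keys q" "w \<in> Poly_Mapping.keys (gen (u @ v) :: 'a list \<Rightarrow>\<^sub>0 'b)"
    by (rule keys_flinE)
  then show ?thesis using assms(1,2) u(1) by simp
qed

lemma keys_iter_cop: "w \<in> Poly_Mapping.keys (iter_cop dlt dgt t x) \<Longrightarrow> length w = inputs t"
proof (induction t arbitrary: x w)
  case (TLt s t)
  from TLt.prems obtain ab where "w \<in> Poly_Mapping.keys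
      (concat_prod (iter_cop dlt dgt s (fst ab)) (iter_cop dlt dgt t (snd ab)))"
    by (auto simp: case_prod_unfold elim: keys_flinE)
  from keys_concat_prod[OF _ _ this] TLt.IH show ?case by simp
next
  case (TGt s t)
  from TGt.prems obtain ab where "w \<in> Poly_Mapping.keys
      (concat_prod (iter_cop dlt dgt s (fst ab)) (iter_cop dlt dgt t (snd ab)))"
    by (auto simp: case_prod_unfold elim: keys_flinE)
  from keys_concat_prod[OF _ _ this] TGt.IH show ?case by simp
qed simp

lemma tens_concat_prod:
  assumes "\<And>u. u \<in> Poly_Mapping.keys p \<Longrightarrow> length u = n" "n \<le> length fs"
  shows "lext (*) (tens fs) (concat_prod p q) =
    lext (*) (tens (take n fs)) p * lext (*) (tens (drop n fs)) q"
proof -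
  have "lext (*) (tens fs) (flin (\<lambda>v. gen (u @ v)) q) = tens (take n fs) u * lext (*) (tens (drop n fs)) q"
    if "u \<in> Poly_Mapping.keys p" for u
  proof -
    have "tens fs (u @ v) = tens (take n fs) u * tens (drop n fs) v" for v
      using tens_append[of "take n fs" u "drop n fs" v] assms that by simp
    then show ?thesis by (simp add: field.lext_flin field.lext_gen mult_lext)
  qed
  then have "lext (*) (tens fs) (concat_prod p q) =
      lext (*) (\<lambda>u. tens (take n fs) u * lext (*) (tens (drop n fs)) q) p"
    unfolding concat_prod_def field.lext_flin by (intro field.lext_cong)
  then show ?thesis by (simp add: lext_mult)
qed

context dup_coalgebra
begin

abbreviation dual_eval :: "dup \<Rightarrow> ('h \<Rightarrow> 'k) list \<Rightarrow> 'h \<Rightarrow> 'k" where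
  "dual_eval \<equiv> dup_eval (dual_op dlt) (dual_op dgt)"

text \<open>Iterating cooperations is transposed to composing products of functionals. The identity
  already holds for the chosen representatives, hence for formal composites and not just for their
  classes.\<close>

lemma tens_iter_cop:
  assumes "length fs = inputs t"
  shows "lext (*) (tens fs) (iter_cop dlt dgt t x) = term_eval (dual_op dlt) (dual_op dgt) t fs x"
  using assms
proof (induction t arbitrary: fs x)
  case TId
  then obtain f where "fs = [f]" by (auto simp: length_Suc_conv)
  then show ?case by (simp add: field.lext_gen)
next
  case (TLt s t)
  then show ?case
    by (simp add: field.lext_flin case_prod_unfold tens_concat_prod[where n="inputs s"] keys_iter_cop dual_op_def)
next
  case (TGt s t)
  then show ?case
    by (simp add: field.lext_flin case_prod_unfold tens_concat_prod[where n="inputs s"] keys_iter_cop dual_op_def)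
qed

lemma tens_iter_cop_dual_eval:
  assumes "set fs \<subseteq> dual scale" "length fs = inputs t"
  shows "lext (*) (tens fs) (iter_cop dlt dgt t x) = dual_eval (abs_dup t) fs x"
  using assms by (simp add: tens_iter_cop dual.term_eval_eq_dup_eval)

text \<open>Congruent composites act alike on linear functionals, so the filtration can be tested on
  \<open>dup\<close>, which has finitely many elements of each arity.\<close>

lemma filt_iff:
  "x \<in> filt scale dlt dgt r \<longleftrightarrow>
    (\<forall>c fs. arity c > r \<longrightarrow> set fs \<subseteq> dual scale \<longrightarrow> length fs = arity c \<longrightarrow> dual_eval c fs x = 0)"
    (is "_ \<longleftrightarrow> (\<forall>c. ?P c)")
proof -
  have "tensor_eq scale (inputs t) (iter_cop dlt dgt t x) 0 \<longleftrightarrow>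
      (\<forall>fs. set fs \<subseteq> dual scale \<longrightarrow> length fs = inputs t \<longrightarrow> dual_eval (abs_dup t) fs x = 0)" for t
    by (subst tensor_eq_iff) (auto simp: keys_iter_cop tens_iter_cop_dual_eval field.lext_zero)
  then have "x \<in> filt scale dlt dgt r \<longleftrightarrow> (\<forall>t. ?P (abs_dup t))"
    unfolding filt_def by (auto simp: arity_abs_dup)
  also have "\<dots> \<longleftrightarrow> (\<forall>c. ?P c)" by (metis abs_rep_dup)
  finally show ?thesis .
qed

lemma dual_eval_dual: "set fs \<subseteq> dual scale \<Longrightarrow> length fs = arity c \<Longrightarrow> dual_eval c fs \<in> dual scale"
  by (rule dual.dup_eval_closed)

end

section \<open>Families of elements on which the cooperations cut operations\<close>

lemma sum_cop_lt: "(\<Sum>x \<in># cop_lt c. F x) = (\<Sum>x | dup_lt (fst x) (snd x) = c. F x)"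
  by (simp add: cop_lt_eq_cofree cofree_cop_lt_def sum_unfold_sum_mset case_prod_unfold)

lemma sum_cop_gt: "(\<Sum>x \<in># cop_gt c. F x) = (\<Sum>x | dup_gt (fst x) (snd x) = c. F x)"
  by (simp add: cop_gt_eq_cofree cofree_cop_gt_def sum_unfold_sum_mset case_prod_unfold)

text \<open>\<open>E c w\<close> is the image of the operation \<open>c\<close> applied to
  \<open>w\<close>. This covers evaluation in a bialgebra as well as the images under an arbitrary
  map that preserves the cooperations, where no products are at hand.\<close>

locale cut_family = dup_coalgebra scale dlt dgt
  for scale :: "'k::field \<Rightarrow> 'h::ab_group_add \<Rightarrow> 'h" and dlt dgt +
  fixes V :: "'h set" and E :: "dup \<Rightarrow> 'h list \<Rightarrow> 'h"
  assumes lt_cuts: "f \<in> dual scale \<Longrightarrow> g \<in> dual scale \<Longrightarrow> set w \<subseteq> V \<Longrightarrow> length w = arity c \<Longrightarrow>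
      dual_op dlt f g (E c w) =
      (\<Sum>x \<in># cop_lt c. f (E (fst x) (take (arity (fst x)) w)) * g (E (snd x) (drop (arity (fst x)) w)))"
    and gt_cuts: "f \<in> dual scale \<Longrightarrow> g \<in> dual scale \<Longrightarrow> set w \<subseteq> V \<Longrightarrow> length w = arity c \<Longrightarrow>
      dual_op dgt f g (E c w) =
      (\<Sum>x \<in># cop_gt c. f (E (fst x) (take (arity (fst x)) w)) * g (E (snd x) (drop (arity (fst x)) w)))"
begin

lemma set_take_drop_V: "set w \<subseteq> V \<Longrightarrow> set (take n w) \<subseteq> V \<and> set (drop n w) \<subseteq> V"
  using set_take_subset[of n w] set_drop_subset[of n w] by blast

text \<open>An operation cannot be cut into more parts than it has inputs: in each cut of
  \<open>c\<close> one part has fewer inputs than its counterpart in \<open>d\<close>, and the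
  corresponding factor vanishes by induction.\<close>

lemma dual_eval_vanishes:
  assumes "arity c < arity d" "set fs \<subseteq> dual scale" "length fs = arity d" "set w \<subseteq> V" "length w = arity c"
  shows "dual_eval d fs (E c w) = 0"
  using assms
proof (induction d arbitrary: c fs w rule: dup_induct)
  case id
  then show ?case using arity_pos[of c] by simp
next
  case (lt d e)
  let ?fs = "take (arity d) fs" and ?gs = "drop (arity d) fs"
  have fs: "set ?fs \<subseteq> dual scale" "set ?gs \<subseteq> dual scale"
    using lt.prems(2) dual.set_take_drop by auto
  have "dual_eval d ?fs (E a (take (arity a) w)) * dual_eval e ?gs (E b (drop (arity a) w)) = 0"
    if "dup_lt a b = c" for a b
  proof (cases "arity a < arity d")
    case True
    then show ?thesis using lt.prems lt.IH(1)[of a ?fs "take (arity a) w"] fs that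
      by (auto simp: set_take_drop_V)
  next
    case False
    then show ?thesis using lt.prems lt.IH(2)[of b ?gs "drop (arity a) w"] fs that
      by (auto simp: set_take_drop_V)
  qed
  then show ?case using lt.prems fs
    by (auto simp: dual.dup_eval_lt lt_cuts dual_eval_dual sum_cop_lt intro!: sum.neutral)
next
  case (gt d e)
  let ?fs = "take (arity d) fs" and ?gs = "drop (arity d) fs"
  have fs: "set ?fs \<subseteq> dual scale" "set ?gs \<subseteq> dual scale"
    using gt.prems(2) dual.set_take_drop by auto
  have "dual_eval d ?fs (E a (take (arity a) w)) * dual_eval e ?gs (E b (drop (arity a) w)) = 0"
    if "dup_gt a b = c" for a b
  proof (cases "arity a < arity d")
    case True
    then show ?thesis using gt.prems gt.IH(1)[of a ?fs "take (arity a) w"] fs that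
      by (auto simp: set_take_drop_V)
  next
    case False
    then show ?thesis using gt.prems gt.IH(2)[of b ?gs "drop (arity a) w"] fs that
      by (auto simp: set_take_drop_V)
  qed
  then show ?case using gt.prems fs
    by (auto simp: dual.dup_eval_gt gt_cuts dual_eval_dual sum_cop_gt intro!: sum.neutral)
qed

text \<open>Up to lower arities, the action of the operations on \<open>E\<close> is the identity matrix.\<close>

lemma dual_eval_pairing:
  assumes id: "\<And>v. v \<in> V \<Longrightarrow> E dup_id [v] = v"
    and "arity c = arity d" "set fs \<subseteq> dual scale" "length fs = arity d" "set w \<subseteq> V" "length w = arity c"
  shows "dual_eval d fs (E c w) = (if c = d then tens fs w else 0)"
  using assms(2-)
proof (induction d arbitrary: c fs w rule: dup_induct)
  case id
  have c: "c = dup_id"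
    using id.prems(1)
  proof (cases c rule: dup_cases)
    case (lt a b)
    then show ?thesis using id.prems(1) arity_pos[of a] arity_pos[of b] by simp
  next
    case (gt a b)
    then show ?thesis using id.prems(1) arity_pos[of a] arity_pos[of b] by simp
  qed simp
  obtain f v where "fs = [f]" "w = [v]"
    using id.prems by (auto simp: c length_Suc_conv)
  then show ?case using id.prems by (simp add: c dual.dup_eval_id assms(1))
next
  case (lt d e)
  let ?fs = "take (arity d) fs" and ?gs = "drop (arity d) fs"
  have fs: "set ?fs \<subseteq> dual scale" "set ?gs \<subseteq> dual scale" "length ?fs = arity d" "length ?gs = arity e"
    using lt.prems dual.set_take_drop by auto
  have "dual_eval d ?fs (E a (take (arity a) w)) * dual_eval e ?gs (E b (drop (arity a) w)) =
      (if (a, b) = (d, e) then tens fs w else 0)" if c: "dup_lt a b = c" for a b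
  proof -
    let ?u = "take (arity a) w" and ?v = "drop (arity a) w"
    have w: "set ?u \<subseteq> V" "set ?v \<subseteq> V" "length ?u = arity a" "length ?v = arity b"
      and ab: "arity a + arity b = arity d + arity e"
      using lt.prems c set_take_drop_V by auto
    \<comment> \<open>The arities of the two parts have equal sums, so unless they agree one part is
      too small and \<open>dual_eval_vanishes\<close> applies.\<close>
    consider "arity a < arity d" | "arity b < arity e" | "arity a = arity d" "arity b = arity e"
      using ab by linarith
    then show ?thesis
    proof cases
      case 1
      then show ?thesis using dual_eval_vanishes[OF 1 fs(1,3) w(1,3)] by auto
    next
      case 2
      then show ?thesis using dual_eval_vanishes[OF 2 fs(2,4) w(2,4)] by auto
    next
      case 3
      then show ?thesis
        using lt.IH(1)[OF 3(1) fs(1,3) w(1,3)] lt.IH(2)[OF 3(2) fs(2,4) w(2,4)]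
          tens_split[of fs w "arity d"] lt.prems by auto
    qed
  qed
  note terms = this
  have "dual_eval (dup_lt d e) fs (E c w) = (\<Sum>x | dup_lt (fst x) (snd x) = c.
      dual_eval d ?fs (E (fst x) (take (arity (fst x)) w)) * dual_eval e ?gs (E (snd x) (drop (arity (fst x)) w)))"
    using lt.prems fs by (simp add: dual.dup_eval_lt lt_cuts dual_eval_dual sum_cop_lt)
  also have "\<dots> = (\<Sum>x | dup_lt (fst x) (snd x) = c. if x = (d, e) then tens fs w else 0)"
  proof (rule sum.cong[OF HOL.refl])
    fix x assume "x \<in> {x. dup_lt (fst x) (snd x) = c}"
    then show "dual_eval d ?fs (E (fst x) (take (arity (fst x)) w)) * dual_eval e ?gs (E (snd x) (drop (arity (fst x)) w)) =
        (if x = (d, e) then tens fs w else 0)"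
      using terms[of "fst x" "snd x"] unfolding prod.collapse by blast
  qed
  also have "\<dots> = (if c = dup_lt d e then tens fs w else 0)"
    using finite_decompositions(1)[of c] by (auto simp: case_prod_unfold)
  finally show ?case .
next
  case (gt d e)
  let ?fs = "take (arity d) fs" and ?gs = "drop (arity d) fs"
  have fs: "set ?fs \<subseteq> dual scale" "set ?gs \<subseteq> dual scale" "length ?fs = arity d" "length ?gs = arity e"
    using gt.prems dual.set_take_drop by auto
  have "dual_eval d ?fs (E a (take (arity a) w)) * dual_eval e ?gs (E b (drop (arity a) w)) =
      (if (a, b) = (d, e) then tens fs w else 0)" if c: "dup_gt a b = c" for a b
  proof -
    let ?u = "take (arity a) w" and ?v = "drop (arity a) w"
    have w: "set ?u \<subseteq> V" "set ?v \<subseteq> V" "length ?u = arity a" "length ?v = arity b"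
      and ab: "arity a + arity b = arity d + arity e"
      using gt.prems c set_take_drop_V by auto
    consider "arity a < arity d" | "arity b < arity e" | "arity a = arity d" "arity b = arity e"
      using ab by linarith
    then show ?thesis
    proof cases
      case 1
      then show ?thesis using dual_eval_vanishes[OF 1 fs(1,3) w(1,3)] by auto
    next
      case 2
      then show ?thesis using dual_eval_vanishes[OF 2 fs(2,4) w(2,4)] by auto
    next
      case 3
      then show ?thesis
        using gt.IH(1)[OF 3(1) fs(1,3) w(1,3)] gt.IH(2)[OF 3(2) fs(2,4) w(2,4)]
          tens_split[of fs w "arity d"] gt.prems by auto
    qed
  qed
  note terms = this
  have "dual_eval (dup_gt d e) fs (E c w) = (\<Sum>x | dup_gt (fst x) (snd x) = c.
      dual_eval d ?fs (E (fst x) (take (arity (fst x)) w)) * dual_eval e ?gs (E (snd x) (drop (arity (fst x)) w)))"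
    using gt.prems fs by (simp add: dual.dup_eval_gt gt_cuts dual_eval_dual sum_cop_gt)
  also have "\<dots> = (\<Sum>x | dup_gt (fst x) (snd x) = c. if x = (d, e) then tens fs w else 0)"
  proof (rule sum.cong[OF HOL.refl])
    fix x assume "x \<in> {x. dup_gt (fst x) (snd x) = c}"
    then show "dual_eval d ?fs (E (fst x) (take (arity (fst x)) w)) * dual_eval e ?gs (E (snd x) (drop (arity (fst x)) w)) =
        (if x = (d, e) then tens fs w else 0)"
      using terms[of "fst x" "snd x"] unfolding prod.collapse by blast
  qed
  also have "\<dots> = (if c = dup_gt d e then tens fs w else 0)"
    using finite_decompositions(2)[of c] by (auto simp: case_prod_unfold)
  finally show ?case .
qed

end

lemma tens_word_cop:
  "lext (*) (tens [f, g]) (flin (\<lambda>(x, y). gen [\<Phi> x, \<Phi> y]) (word_cop cop p)) =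
    lext (*) (\<lambda>(c, w). \<Sum>x\<in>#cop c. f (\<Phi> (fst x, take (arity (fst x)) w)) *
      g (\<Phi> (snd x, drop (arity (fst x)) w))) p"
  by (simp add: tens_pairs[where \<phi>=\<Phi> and \<psi>=\<Phi>] word_cop_def field.lext_flin case_prod_unfold
      field.lext_sum_mset field.lext_gen)

lemma gen_in_dup_space [simp]: "gen (c, w) \<in> dup_space V \<longleftrightarrow> length w = arity c \<and> set w \<subseteq> V"
  by (simp add: dup_space_def)

context dup_coalgebra
begin

lemma preserves_cop_tens:
  assumes "preserves_cop scale V cop \<delta> \<Phi>" "f \<in> dual scale" "g \<in> dual scale" "p \<in> dup_space V"
  shows "dual_op \<delta> f g (\<Phi> p) = lext (*) (\<lambda>(c, w). \<Sum>x\<in>#cop c. f (\<Phi> (gen (fst x, take (arity (fst x)) w))) *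
      g (\<Phi> (gen (snd x, drop (arity (fst x)) w)))) p"
proof -
  have "lext (*) (tens [f, g]) (pair_word (\<delta> (\<Phi> p))) =
      lext (*) (tens [f, g]) (flin (\<lambda>(x, y). gen [\<Phi> (gen x), \<Phi> (gen y)]) (word_cop cop p))"
    using assms unfolding preserves_cop_def by (intro tensor_eqD[of 2]) auto
  then show ?thesis
    unfolding tens_word_cop[where \<Phi>="\<lambda>x. \<Phi> (gen x)"] by (simp add: tens_pairs dual_op_def)
qed

lemma cut_family_of_preserves_cop:
  assumes "preserves_cop scale V cop_lt dlt \<Phi>" "preserves_cop scale V cop_gt dgt \<Phi>"
  shows "cut_family scale dlt dgt V (\<lambda>c w. \<Phi> (gen (c, w)))"
  by unfold_locales
    (simp_all add: preserves_cop_tens[OF assms(1)] preserves_cop_tens[OF assms(2)] field.lext_gen)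

text \<open>An element involves finitely many operations, and iterated cooperations of larger arity
  kill them all. Only the cut formula enters, so that (b) and (c) are handled together.\<close>

lemma connected_of_preserves_cop:
  assumes \<Phi>: "linear_iso_from_dup scale V \<Phi>"
    and "preserves_cop scale V cop_lt dlt \<Phi>" "preserves_cop scale V cop_gt dgt \<Phi>"
  shows "connected_coalgebra scale dlt dgt"
proof -
  interpret cut_family scale dlt dgt V "\<lambda>c w. \<Phi> (gen (c, w))"
    using assms(2,3) by (rule cut_family_of_preserves_cop)
  have "\<exists>r. x \<in> filt scale dlt dgt r" for x
  proof -
    obtain p where p: "p \<in> dup_space V" "x = \<Phi> p"
      using \<Phi> unfolding linear_iso_from_dup_def by blast
    \<comment> \<open>The inserted 0 covers \<open>p = 0\<close>, where the maximum would be over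
      the empty set.\<close>
    define r where "r = Max (insert 0 ((\<lambda>(c, w). arity c) ` Poly_Mapping.keys p))"
    have r: "arity c \<le> r" if "(c, w) \<in> Poly_Mapping.keys p" for c w
      unfolding r_def using that by (intro Max_ge) force+
    have "x \<in> filt scale dlt dgt r"
      unfolding filt_iff
    proof (intro allI impI)
      fix d fs assume d: "r < arity d" and fs: "set fs \<subseteq> dual scale" "length fs = arity d"
      have "Vector_Spaces.linear scale (*) (dual_eval d fs)"
        using dual_eval_dual[OF fs] by (simp add: dual_def)
      then have "dual_eval d fs x = lext (*) (\<lambda>y. dual_eval d fs (\<Phi> (gen y))) p"
        using \<Phi> linear_on_formal[of scale \<Phi> p] linear_of_lext[of scale "(*)"]
        unfolding linear_iso_from_dup_def p(2) by metis
      also have "\<dots> = 0"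
        using p(1) fs d r
        by (intro field.lext_eq_0)
          (fastforce simp: dup_space_def intro!: dual_eval_vanishes)
      finally show "dual_eval d fs x = 0" .
    qed
    then show ?thesis ..
  qed
  then show ?thesis unfolding connected_coalgebra_def by blast
qed

end

section \<open>The canonical map from the free algebra\<close>

lemma cop_lt_arity: "(a, b) \<in># cop_lt c \<Longrightarrow> arity a + arity b = arity c"
  by (auto simp: cop_lt_iff)

lemma cop_gt_arity: "(a, b) \<in># cop_gt c \<Longrightarrow> arity a + arity b = arity c"
  by (auto simp: cop_gt_iff)

context inf_bidup_bialgebra
begin

abbreviation ev :: "dup \<Rightarrow> 'h list \<Rightarrow> 'h" where "ev \<equiv> dup_eval lt gt"
abbreviation primitives :: "'h set" where "primitives \<equiv> prim scale dlt dgt"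

lemma ev_simps:
  "length w = arity a + arity b \<Longrightarrow> ev (dup_lt a b) w = ev a (take (arity a) w) \<prec> ev b (drop (arity a) w)"
  "length w = arity a + arity b \<Longrightarrow> ev (dup_gt a b) w = ev a (take (arity a) w) \<succ> ev b (drop (arity a) w)"
  by (simp_all add: algebra.dup_eval_lt algebra.dup_eval_gt)

text \<open>A first part inside \<open>x\<close> has fewer inputs than \<open>x\<close>, so cutting
  \<open>w\<close> there means cutting its first \<open>arity x\<close> letters and multiplying the
  second piece by the value of \<open>y\<close>. Cooperation and product vary independently because
  the mixed compatibility relations cut with one and multiply with the other.\<close>

lemma cut_right:
  assumes M: "M = cop_lt x \<or> M = cop_gt x"
    and m: "(m, op) = (dup_lt, lt) \<or> (m, op) = (dup_gt, gt)"
    and w: "length w = arity x + arity y"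
  shows "(\<Sum>z\<in>#{#(a, m b y). (a, b) \<in># M#}. f (ev (fst z) (take (arity (fst z)) w)) * g (ev (snd z) (drop (arity (fst z)) w))) =
    (\<Sum>z\<in>#M. f (ev (fst z) (take (arity (fst z)) (take (arity x) w))) *
      g (op (ev (snd z) (drop (arity (fst z)) (take (arity x) w))) (ev y (drop (arity x) w))))"
proof -
  have ev: "ev (m a b) w = op (ev a (take (arity a) w)) (ev b (drop (arity a) w))"
    if "length w = arity a + arity b" for a b w
    using m that by (auto simp: ev_simps)
  have ar: "arity (m a b) = arity a + arity b" for a b using m by auto
  have "\<forall>(a, b)\<in>#M. arity a + arity b = arity x"
    using M by (auto simp: cop_lt_arity cop_gt_arity)
  then show ?thesis
  proof (induction M)
  case (add z M)
  obtain a b where z: "z = (a, b)" by fastforce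
  have ab: "arity a + arity b = arity x" using add.prems by (auto simp: z)
  then have "ev (m b y) (drop (arity a) w) = op (ev b (drop (arity a) (take (arity x) w))) (ev y (drop (arity x) w))"
    using ev[of "drop (arity a) w" b y] w by (simp add: drop_take add.commute flip: ab)
  moreover have "take (arity a) w = take (arity a) (take (arity x) w)" using ab by (simp add: min_def)
  ultimately show ?case using add.IH add.prems by (simp add: z)
  qed simp
qed

lemma cut_left:
  assumes M: "M = cop_lt y \<or> M = cop_gt y"
    and m: "(m, op) = (dup_lt, lt) \<or> (m, op) = (dup_gt, gt)"
    and w: "length w = arity x + arity y"
  shows "(\<Sum>z\<in>#{#(m x a, b). (a, b) \<in># M#}. f (ev (fst z) (take (arity (fst z)) w)) * g (ev (snd z) (drop (arity (fst z)) w))) =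
    (\<Sum>z\<in>#M. f (op (ev x (take (arity x) w)) (ev (fst z) (take (arity (fst z)) (drop (arity x) w)))) *
      g (ev (snd z) (drop (arity (fst z)) (drop (arity x) w))))"
proof -
  have ev: "ev (m a b) w = op (ev a (take (arity a) w)) (ev b (drop (arity a) w))"
    if "length w = arity a + arity b" for a b w
    using m that by (auto simp: ev_simps)
  have ar: "arity (m a b) = arity a + arity b" for a b using m by auto
  have "\<forall>(a, b)\<in>#M. arity a + arity b = arity y"
    using M by (auto simp: cop_lt_arity cop_gt_arity)
  then show ?thesis
  proof (induction M)
  case (add z M)
  obtain a b where z: "z = (a, b)" by fastforce
  have "arity a + arity b = arity y" using add.prems by (auto simp: z)
  then have le: "arity x + arity a \<le> length w" using w by simp
  show ?case using add.IH add.prems le w by (simp add: z ev ar drop_take add.commute)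
  qed simp
qed

text \<open>The transposed compatibility relations have the shape of the recursions for
  \<open>cop_lt\<close> and \<open>cop_gt\<close>, and primitivity gives the empty sum at the
  identity. The functionals stay arbitrary in the induction because each step composes one of them
  with a multiplication.\<close>

lemma ev_cuts:
  assumes "f \<in> dual scale" "g \<in> dual scale" "set w \<subseteq> primitives" "length w = arity c"
  shows "(f \<triangleleft> g) (ev c w) =
      (\<Sum>x \<in># cop_lt c. f (ev (fst x) (take (arity (fst x)) w)) * g (ev (snd x) (drop (arity (fst x)) w)))"
    "(f \<triangleright> g) (ev c w) =
      (\<Sum>x \<in># cop_gt c. f (ev (fst x) (take (arity (fst x)) w)) * g (ev (snd x) (drop (arity (fst x)) w)))"
  using assms
proof (induction c arbitrary: f g w rule: dup_induct)
  case id
  {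
    case 1
    then obtain v where "w = [v]" by (auto simp: length_Suc_conv)
    with 1 show ?case by (simp add: cop_lt_simps algebra.dup_eval_id prim_iff)
  next
    case 2
    then obtain v where "w = [v]" by (auto simp: length_Suc_conv)
    with 2 show ?case by (simp add: cop_gt_simps algebra.dup_eval_id prim_iff)
  }
next
  case (lt x y)
  {
    case 1
    then have w: "set (take (arity x) w) \<subseteq> primitives" "set (drop (arity x) w) \<subseteq> primitives"
      "length (take (arity x) w) = arity x" "length (drop (arity x) w) = arity y"
      "length w = arity x + arity y"
      using set_take_subset[of "arity x" w] set_drop_subset[of "arity x" w] by auto
    show ?case
      unfolding cop_lt_simps image_mset_union sum_mset.union
        cut_right[where M="cop_lt x" and f=f and g=g, OF disjI1[OF HOL.refl] disjI1[OF HOL.refl] w(5)]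
        cut_left[where M="cop_lt y" and f=f and g=g, OF disjI1[OF HOL.refl] disjI1[OF HOL.refl] w(5)]
        ev_simps(1)[OF w(5)] dual_of_products(4)[OF 1(1,2)]
        lt.IH(1)[OF 1(1) dual_compose(1)[OF 1(2)] w(1,3)]
        lt.IH(3)[OF dual_compose(3)[OF 1(1)] 1(2) w(2,4)] by simp
  next
    case 2
    then have w: "set (take (arity x) w) \<subseteq> primitives" "set (drop (arity x) w) \<subseteq> primitives"
      "length (take (arity x) w) = arity x" "length (drop (arity x) w) = arity y"
      "length w = arity x + arity y"
      using set_take_subset[of "arity x" w] set_drop_subset[of "arity x" w] by auto
    show ?case
      unfolding cop_gt_simps image_mset_union sum_mset.union
        cut_right[where M="cop_gt x" and f=f and g=g, OF disjI2[OF HOL.refl] disjI1[OF HOL.refl] w(5)]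
        ev_simps(1)[OF w(5)] dual_of_products(3)[OF 2(1,2)]
        lt.IH(2)[OF 2(1) dual_compose(1)[OF 2(2)] w(1,3)] by simp
  }
next
  case (gt x y)
  {
    case 1
    then have w: "set (take (arity x) w) \<subseteq> primitives" "set (drop (arity x) w) \<subseteq> primitives"
      "length (take (arity x) w) = arity x" "length (drop (arity x) w) = arity y"
      "length w = arity x + arity y"
      using set_take_subset[of "arity x" w] set_drop_subset[of "arity x" w] by auto
    show ?case
      unfolding cop_lt_simps image_mset_union sum_mset.union
        cut_left[where M="cop_lt y" and f=f and g=g, OF disjI1[OF HOL.refl] disjI2[OF HOL.refl] w(5)]
        ev_simps(2)[OF w(5)] dual_of_products(2)[OF 1(1,2)]
        gt.IH(3)[OF dual_compose(4)[OF 1(1)] 1(2) w(2,4)] by simp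
  next
    case 2
    then have w: "set (take (arity x) w) \<subseteq> primitives" "set (drop (arity x) w) \<subseteq> primitives"
      "length (take (arity x) w) = arity x" "length (drop (arity x) w) = arity y"
      "length w = arity x + arity y"
      using set_take_subset[of "arity x" w] set_drop_subset[of "arity x" w] by auto
    show ?case
      unfolding cop_gt_simps image_mset_union sum_mset.union
        cut_right[where M="cop_gt x" and f=f and g=g, OF disjI2[OF HOL.refl] disjI2[OF HOL.refl] w(5)]
        cut_left[where M="cop_gt y" and f=f and g=g, OF disjI2[OF HOL.refl] disjI2[OF HOL.refl] w(5)]
        ev_simps(2)[OF w(5)] dual_of_products(1)[OF 2(1,2)]
        gt.IH(2)[OF 2(1) dual_compose(2)[OF 2(2)] w(1,3)]
        gt.IH(4)[OF dual_compose(4)[OF 2(1)] 2(2) w(2,4)] by simp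
  }
qed

end

sublocale inf_bidup_bialgebra \<subseteq> free: cut_family scale dlt dgt "prim scale dlt dgt" "dup_eval lt gt"
  by unfold_locales (rule ev_cuts; assumption)+

context inf_bidup_bialgebra
begin

text \<open>On the free algebra over a subspace this is the algebra map extending the inclusion: it
  multiplies out formal products.\<close>

definition realize :: "('h, 'k) dup_comb \<Rightarrow> 'h" where
  "realize = lext scale (\<lambda>(c, w). ev c w)"

lemma realize_preserves_product:
  "preserves_product V dup_lt lt realize" "preserves_product V dup_gt gt realize"
proof -
  have *: "realize (dup_product m p q) = op (realize p) (realize q)"
    if "\<And>y. Vector_Spaces.linear scale scale (\<lambda>x. op x y)" "\<And>x. Vector_Spaces.linear scale scale (\<lambda>y. op x y)"
      and ev: "\<And>a b u w. length u = arity a \<Longrightarrow> length w = arity b \<Longrightarrow> ev (m a b) (u @ w) = op (ev a u) (ev b w)"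
      and pq: "p \<in> dup_space V" "q \<in> dup_space V" for m op p q
  proof -
    have "realize (dup_product m p q) = lext scale (\<lambda>x. lext scale (\<lambda>y. ev (m (fst x) (fst y)) (snd x @ snd y)) q) p"
      by (simp add: realize_def dup_product_def lext_flin lext_gen case_prod_unfold)
    also have "\<dots> = lext scale (\<lambda>x. lext scale (\<lambda>y. op (ev (fst x) (snd x)) (ev (fst y) (snd y))) q) p"
      using pq by (intro lext_cong) (auto simp: dup_space_def intro!: ev)
    also have "\<dots> = op (realize p) (realize q)"
    proof -
      have inner: "lext scale (\<lambda>y. op z (ev (fst y) (snd y))) q = op z (realize q)" for z
        by (simp add: realize_def case_prod_unfold linear_of_lext[OF that(2)])
      have outer: "realize p = lext scale (\<lambda>x. ev (fst x) (snd x)) p"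
        by (simp add: realize_def case_prod_unfold)
      show ?thesis unfolding inner outer linear_of_lext[OF that(1)] ..
    qed
    finally show ?thesis .
  qed
  show "preserves_product V dup_lt lt realize" "preserves_product V dup_gt gt realize"
    unfolding preserves_product_def
    using *[OF lt_linear_left lt_linear_right] *[OF gt_linear_left gt_linear_right]
    by (auto simp: algebra.dup_eval_lt_append algebra.dup_eval_gt_append)
qed

lemma realize_gen: "realize (gen (c, w)) = ev c w"
  by (simp add: realize_def lext_gen)

lemma linear_realize: "Vector_Spaces.linear fscale scale realize"
  unfolding realize_def by (rule linear_lext)

lemma dual_realize:
  assumes "f \<in> dual scale"
  shows "f (realize p) = lext (*) (\<lambda>(c, w). f (ev c w)) p"
  using linear_of_lext[of scale "(*)" f "\<lambda>(c, w). ev c w" p] assms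
  by (simp add: dual_def realize_def case_prod_unfold)

lemma realize_preserves_cop:
  "preserves_cop scale primitives cop_lt dlt realize" "preserves_cop scale primitives cop_gt dgt realize"
proof -
  have *: "tensor_eq scale 2 (pair_word (\<delta> (realize p))) (flin (\<lambda>(x, y). gen [realize (gen x), realize (gen y)]) (word_cop cop p))"
    if \<delta>: "\<And>f g. f \<in> dual scale \<Longrightarrow> g \<in> dual scale \<Longrightarrow> dual_op \<delta> f g \<in> dual scale"
      and cuts: "\<And>f g w c. f \<in> dual scale \<Longrightarrow> g \<in> dual scale \<Longrightarrow> set w \<subseteq> primitives \<Longrightarrow> length w = arity c \<Longrightarrow>
        dual_op \<delta> f g (ev c w) =
      (\<Sum>x \<in># cop c. f (ev (fst x) (take (arity (fst x)) w)) * g (ev (snd x) (drop (arity (fst x)) w)))"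
      and p: "p \<in> dup_space primitives" for \<delta> cop p
  proof (subst tensor_eq_2_iff)
    show "\<forall>f\<in>dual scale. \<forall>g\<in>dual scale. lext (*) (tens [f, g]) (pair_word (\<delta> (realize p))) =
      lext (*) (tens [f, g]) (flin (\<lambda>(x, y). gen [realize (gen x), realize (gen y)]) (word_cop cop p))"
    proof (intro ballI)
      fix f g assume fg: "f \<in> dual scale" "g \<in> dual scale"
      have "lext (*) (tens [f, g]) (pair_word (\<delta> (realize p))) = dual_op \<delta> f g (realize p)"
        by (simp add: tens_pairs dual_op_def)
      also have "\<dots> = lext (*) (\<lambda>(c, w). dual_op \<delta> f g (ev c w)) p"
        by (rule dual_realize[OF \<delta>[OF fg]])
      also have "\<dots> = lext (*) (\<lambda>(c, w). \<Sum>x \<in># cop c. f (ev (fst x) (take (arity (fst x)) w)) *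
          g (ev (snd x) (drop (arity (fst x)) w))) p"
        using p by (intro field.lext_cong) (auto simp: dup_space_def intro!: cuts fg)
      finally show "lext (*) (tens [f, g]) (pair_word (\<delta> (realize p))) =
        lext (*) (tens [f, g]) (flin (\<lambda>(x, y). gen [realize (gen x), realize (gen y)]) (word_cop cop p))"
        unfolding tens_word_cop[where \<Phi>="\<lambda>x. realize (gen x)"] realize_gen .
    qed
  qed (auto dest: keys_pairs[where \<phi>="\<lambda>a b. a" and \<psi>="\<lambda>a b. b"]
      keys_pairs[where \<phi>="\<lambda>a b. realize (gen a)" and \<psi>="\<lambda>a b. realize (gen b)"])
  show "preserves_cop scale primitives cop_lt dlt realize"
    unfolding preserves_cop_def by (rule ballI, rule *[OF dual_lt_dual ev_cuts(1)])
  show "preserves_cop scale primitives cop_gt dgt realize"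
    unfolding preserves_cop_def by (rule ballI, rule *[OF dual_gt_dual ev_cuts(2)])
qed

text \<open>The slot of \<open>a\<close> lies in one of the two factors while the other factor stays
  constant. Multilinearity is what makes \<open>realize\<close> kill the tensor relations.\<close>

lemma linear_ev:
  assumes "Suc (length u + length w) = arity c"
  shows "Vector_Spaces.linear scale scale (\<lambda>a. ev c (u @ a # w))"
  using assms
proof (induction c arbitrary: u w rule: dup_induct)
  case id
  then show ?case by (simp add: algebra.dup_eval_id linear_id[unfolded id_def])
next
  case (lt x y)
  show ?case
  proof (cases "length u < arity x")
    case True
    then have "ev (dup_lt x y) (u @ a # w) =
        ev x (u @ a # take (arity x - Suc (length u)) w) \<prec> ev y (drop (arity x - Suc (length u)) w)" for a
      using lt.prems by (auto simp: ev_simps dest!: less_imp_Suc_add)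
    moreover have "Vector_Spaces.linear scale scale (\<lambda>a. ev x (u @ a # take (arity x - Suc (length u)) w))"
      using True lt.prems by (intro lt.IH(1)) auto
    ultimately show ?thesis
      using lt_linear_left unfolding Vector_Spaces.linear_iff by simp
  next
    case False
    then have "ev (dup_lt x y) (u @ a # w) = ev x (take (arity x) u) \<prec> ev y (drop (arity x) u @ a # w)" for a
      using lt.prems by (simp add: ev_simps)
    moreover have "Vector_Spaces.linear scale scale (\<lambda>a. ev y (drop (arity x) u @ a # w))"
      using False lt.prems by (intro lt.IH(2)) auto
    ultimately show ?thesis
      using lt_linear_right unfolding Vector_Spaces.linear_iff by simp
  qed
next
  case (gt x y)
  show ?case
  proof (cases "length u < arity x")
    case True
    then have "ev (dup_gt x y) (u @ a # w) =
        ev x (u @ a # take (arity x - Suc (length u)) w) \<succ> ev y (drop (arity x - Suc (length u)) w)" for a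
      using gt.prems by (auto simp: ev_simps dest!: less_imp_Suc_add)
    moreover have "Vector_Spaces.linear scale scale (\<lambda>a. ev x (u @ a # take (arity x - Suc (length u)) w))"
      using True gt.prems by (intro gt.IH(1)) auto
    ultimately show ?thesis
      using gt_linear_left unfolding Vector_Spaces.linear_iff by simp
  next
    case False
    then have "ev (dup_gt x y) (u @ a # w) = ev x (take (arity x) u) \<succ> ev y (drop (arity x) u @ a # w)" for a
      using gt.prems by (simp add: ev_simps)
    moreover have "Vector_Spaces.linear scale scale (\<lambda>a. ev y (drop (arity x) u @ a # w))"
      using False gt.prems by (intro gt.IH(2)) auto
    ultimately show ?thesis
      using gt_linear_right unfolding Vector_Spaces.linear_iff by simp
  qed
qed

lemma realize_tag: "realize (flin (\<lambda>w. gen (c, w)) q) = lext scale (ev c) q"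
  by (simp add: realize_def lext_flin lext_gen)

lemma realize_tensor_rels:
  assumes "r \<in> formal.span (tensor_rels scale V (arity c))"
  shows "realize (flin (\<lambda>w. gen (c, w)) r) = 0"
proof -
  have "lext scale (ev c) r = 0" if "r \<in> tensor_rels scale V (arity c)" for r
    using that unfolding tensor_rels_def
  proof (elim UnE CollectE exE conjE)
    fix u w a b assume r: "r = gen (u @ (a + b) # w) - gen (u @ a # w) - gen (u @ b # w)"
      and "Suc (length u + length w) = arity c"
    then show ?thesis using linear_ev[of u w c]
      unfolding r lext_diff lext_gen Vector_Spaces.linear_iff by simp
  next
    fix u w k a assume r: "r = gen (u @ scale k a # w) - fscale k (gen (u @ a # w))"
      and "Suc (length u + length w) = arity c"
    then show ?thesis using linear_ev[of u w c]
      unfolding r lext_diff lext_fscale lext_gen Vector_Spaces.linear_iff by simp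
  qed
  note rels = this
  from assms show ?thesis unfolding realize_tag
    by (induction rule: formal.span_induct_alt) (auto simp: rels lext_zero lext_add lext_fscale)
qed

end

section \<open>Injectivity\<close>

text \<open>Together with \<open>tag\<close> this realizes Dup(V) as a direct sum of tensor powers
  indexed by the basis operations: \<open>component c\<close> projects to the summand of
  \<open>c\<close>, \<open>tag c\<close> includes it.\<close>

definition component :: "dup \<Rightarrow> ('v, 'k::field) dup_comb \<Rightarrow> ('v list \<Rightarrow>\<^sub>0 'k)" where
  "component c p = flin (\<lambda>(d, w). if d = c then gen w else 0) p"

definition tag :: "dup \<Rightarrow> ('v list \<Rightarrow>\<^sub>0 'k) \<Rightarrow> ('v, 'k::field) dup_comb" where
  "tag c q = flin (\<lambda>w. gen (c, w)) q"

lemma lookup_component: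
  fixes p :: "('v, 'k::field) dup_comb"
  shows "Poly_Mapping.lookup (component c p) w = Poly_Mapping.lookup p (c, w)"
proof -
  have "Poly_Mapping.lookup (case x of (d, w) \<Rightarrow> if d = c then gen w else 0) w = (if x = (c, w) then 1 else (0::'k))" for x
    by (cases x) (auto simp: lookup_single when_def)
  note * = this
  show ?thesis unfolding component_def lookup_flin *
    by (simp add: lext_def in_keys_iff if_distrib cong: if_cong)
qed

lemma lookup_tag:
  fixes q :: "'v list \<Rightarrow>\<^sub>0 'k::field"
  shows "Poly_Mapping.lookup (tag c q) (d, w) = (if d = c then Poly_Mapping.lookup q w else 0)"
proof -
  have "Poly_Mapping.lookup (gen (c, x)) (d, w) = (if x = w then if d = c then 1 else 0 else (0::'k))" for x
    by (auto simp: lookup_single when_def)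
  note * = this
  show ?thesis unfolding tag_def lookup_flin *
    by (simp add: lext_def in_keys_iff if_distrib cong: if_cong)
qed

lemma sum_tag_component: "(\<Sum>c\<in>fst ` Poly_Mapping.keys p. tag c (component c p)) = p"
proof (rule poly_mapping_eqI, clarify)
  fix c w
  have "c \<notin> fst ` Poly_Mapping.keys p \<Longrightarrow> Poly_Mapping.lookup p (c, w) = 0"
    by (force simp: in_keys_iff)
  then show "Poly_Mapping.lookup (\<Sum>c\<in>fst ` Poly_Mapping.keys p. tag c (component c p)) (c, w) =
      Poly_Mapping.lookup p (c, w)"
    by (simp add: lookup_sum lookup_tag lookup_component)
qed

lemma component_words:
  assumes "p \<in> dup_space V" "w \<in> Poly_Mapping.keys (component c p)"
  shows "length w = arity c \<and> set w \<subseteq> V"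
proof -
  have "(c, w) \<in> Poly_Mapping.keys p" using assms(2) by (simp add: in_keys_iff lookup_component)
  then show ?thesis using assms(1) unfolding dup_space_def by blast
qed

lemma dup_space_diff:
  assumes "p \<in> dup_space V" "q \<in> dup_space V"
  shows "p - q \<in> dup_space V"
  using assms keys_diff[of p q] unfolding dup_space_def by blast

lemma tag_in_dup_space:
  assumes "\<And>w. w \<in> Poly_Mapping.keys q \<Longrightarrow> length w = arity c \<and> set w \<subseteq> V"
  shows "tag c q \<in> dup_space V"
proof (unfold dup_space_def, rule CollectI, rule ballI)
  fix x assume "x \<in> Poly_Mapping.keys (tag c q)"
  then have "fst x = c" "snd x \<in> Poly_Mapping.keys q"
    by (cases x, auto simp: in_keys_iff lookup_tag split: if_splits)+
  then show "case x of (c, w) \<Rightarrow> length w = arity c \<and> set w \<subseteq> V"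
    using assms[of "snd x"] by (simp add: case_prod_unfold)
qed

lemma dup_space_sum:
  assumes "\<And>x. x \<in> A \<Longrightarrow> F x \<in> dup_space V"
  shows "sum F A \<in> dup_space V"
  using assms keys_sum[of F A] unfolding dup_space_def by blast

lemma linear_tag: "Vector_Spaces.linear fscale fscale (tag c)"
  unfolding tag_def[abs_def] flin_eq_lext by (rule formal.linear_lext)

lemma tag_span_tensor_rels:
  assumes "r \<in> formal.span (tensor_rels scale V (arity c))"
  shows "tag c r \<in> dup_null scale V"
proof -
  interpret t: Vector_Spaces.linear fscale fscale "tag c" by (rule linear_tag)
  have "tag c r \<in> formal.span (tag c ` tensor_rels scale V (arity c))"
    using assms unfolding t.span_image by blast
  moreover have "tag c ` tensor_rels scale V (arity c) \<subseteq>
      (\<Union>c. flin (\<lambda>w. gen (c, w)) ` tensor_rels scale V (arity c))"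
    by (auto simp: tag_def)
  ultimately show ?thesis unfolding dup_null_def using formal.span_mono by blast
qed

context inf_bidup_bialgebra
begin

interpretation realize: Vector_Spaces.linear fscale scale realize
  by (rule linear_realize)

lemma realize_null:
  assumes "p \<in> dup_null scale V"
  shows "realize p = 0"
  using assms unfolding dup_null_def
  by (induction rule: formal.span_induct_alt)
    (auto simp: realize.add realize.scale realize_tensor_rels[OF formal.span_base])

text \<open>The two pairing results combined: iterated cooperations against \<open>realize\<close>
  form a matrix that is triangular for the arity, with the identity on the diagonal.\<close>

lemma dual_eval_realize_tag:
  assumes q: "\<And>w. w \<in> Poly_Mapping.keys q \<Longrightarrow> length w = arity c \<and> set w \<subseteq> primitives"
    and fs: "set fs \<subseteq> dual scale" "length fs = arity d" and "arity c \<le> arity d"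
  shows "dual_eval d fs (realize (tag c q)) = (if c = d then lext (*) (tens fs) q else 0)"
proof -
  have "Vector_Spaces.linear scale (*) (dual_eval d fs)"
    using dual_eval_dual[OF fs] by (simp add: dual_def)
  then have "dual_eval d fs (realize (tag c q)) = lext (*) (\<lambda>w. dual_eval d fs (ev c w)) q"
    unfolding tag_def realize_tag by (rule linear_of_lext)
  also have "\<dots> = lext (*) (\<lambda>w. if c = d then tens fs w else 0) q"
  proof (rule field.lext_cong)
    fix w assume "w \<in> Poly_Mapping.keys q"
    then have w: "set w \<subseteq> primitives" "length w = arity c" using q by auto
    show "dual_eval d fs (ev c w) = (if c = d then tens fs w else 0)"
    proof (cases "arity c = arity d")
      case True
      then show ?thesis using free.dual_eval_pairing[OF _ True fs w] algebra.dup_eval_id by simp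
    next
      case False
      then show ?thesis using free.dual_eval_vanishes[OF _ fs w] assms(4) by auto
    qed
  qed
  also have "\<dots> = (if c = d then lext (*) (tens fs) q else 0)"
    by (simp add: field.lext_eq_0)
  finally show ?thesis .
qed

text \<open>Descent in the arity: the iterated cooperation \<open>c\<close> isolates the component
  of \<open>c\<close>, since the others of at most its arity drop out by triangularity and those of
  larger arity are already known to be null.\<close>

lemma component_of_realize_0:
  assumes p: "p \<in> dup_space primitives" "realize p = 0"
  shows "component c p \<in> formal.span (tensor_rels scale primitives (arity c))"
proof -
  define C where "C = fst ` Poly_Mapping.keys p"
  define N where "N = Max (arity ` C)"
  have C: "finite C" by (simp add: C_def)
  show ?thesis
  \<comment> \<open>The truncated difference is 0 once \<open>arity c\<close> reaches
    \<open>N\<close>; no component of \<open>p\<close> has arity above \<open>N\<close>, so no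
    induction hypothesis is called for there.\<close>
  proof (induction "N - arity c" arbitrary: c rule: less_induct)
    case less
    show ?case
    proof (subst span_tensor_rels_iff[OF subspace_prim])
      show "length w = arity c \<and> set w \<subseteq> primitives" if "w \<in> Poly_Mapping.keys (component c p)" for w
        using component_words[OF p(1) that] .
      show "\<forall>fs. set fs \<subseteq> dual scale \<and> length fs = arity c \<longrightarrow> lext (*) (tens fs) (component c p) = 0"
      proof (intro allI impI, elim conjE)
        fix fs assume fs: "set fs \<subseteq> dual scale" "length fs = arity c"
        have terms: "dual_eval c fs (realize (tag d (component d p))) =
            (if d = c then lext (*) (tens fs) (component c p) else 0)" if "d \<in> C" for d
        proof (cases "arity d \<le> arity c")
          case True
          then show ?thesis using dual_eval_realize_tag[OF component_words[OF p(1)] fs True] by auto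
        next
          case False
          moreover have "arity d \<le> N" unfolding N_def using C that by simp
          ultimately have "component d p \<in> formal.span (tensor_rels scale primitives (arity d))"
            by (intro less) linarith
          then have "realize (tag d (component d p)) = 0"
            unfolding tag_def by (rule realize_tensor_rels)
          then show ?thesis using False dual_zero[OF dual_eval_dual[OF fs]] by auto
        qed
        have D: "Vector_Spaces.linear scale (*) (dual_eval c fs)"
          using dual_eval_dual[OF fs] by (simp add: dual_def)
        interpret D: Vector_Spaces.linear scale "(*)" "dual_eval c fs" by (rule D)
        have "0 = dual_eval c fs (realize p)" by (simp add: p(2) D.zero)
        also have "realize p = (\<Sum>d\<in>C. realize (tag d (component d p)))"
          using arg_cong[OF sum_tag_component[of p], of realize] by (simp add: realize.sum C_def)
        also have "dual_eval c fs \<dots> = (\<Sum>d\<in>C. if d = c then lext (*) (tens fs) (component c p) else 0)"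
          unfolding D.sum using terms by (rule sum.cong[OF HOL.refl])
        also have "\<dots> = (if c \<in> C then lext (*) (tens fs) (component c p) else 0)"
          using C by simp
        finally have *: "c \<in> C \<Longrightarrow> lext (*) (tens fs) (component c p) = 0" by simp
        have "c \<notin> C \<Longrightarrow> component c p = 0"
          by (rule poly_mapping_eqI) (force simp: lookup_component C_def in_keys_iff)
        then show "lext (*) (tens fs) (component c p) = 0"
          using * by (cases "c \<in> C") (auto simp: field.lext_zero)
      qed
    qed
  qed
qed

lemma realize_eq_0_iff:
  assumes "p \<in> dup_space primitives"
  shows "realize p = 0 \<longleftrightarrow> p \<in> dup_null scale primitives"
proof
  assume "realize p = 0"
  then have "tag c (component c p) \<in> dup_null scale primitives" for c
    using assms by (intro tag_span_tensor_rels component_of_realize_0)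
  then have "(\<Sum>c\<in>fst ` Poly_Mapping.keys p. tag c (component c p)) \<in> dup_null scale primitives"
    unfolding dup_null_def by (intro formal.span_sum)
  then show "p \<in> dup_null scale primitives" unfolding sum_tag_component .
qed (rule realize_null)

end

section \<open>Surjectivity\<close>

context dup_coalgebra
begin

text \<open>The vector is obtained from \<open>\<delta> x\<close> by contracting the right tensor
  factor with \<open>h\<close>.\<close>

lemma contract_right:
  obtains y where "\<And>g. g \<in> dual scale \<Longrightarrow> g y = dual_op \<delta> g h x"
proof
  fix g assume g: "g \<in> dual scale"
  then have "g (lext scale (\<lambda>z. scale (h (snd z)) (fst z)) (\<delta> x)) =
      lext (*) (\<lambda>z. g (scale (h (snd z)) (fst z))) (\<delta> x)"
    unfolding dual_def by (intro linear_of_lext) simp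
  then show "g (lext scale (\<lambda>z. scale (h (snd z)) (fst z)) (\<delta> x)) = dual_op \<delta> g h x"
    using g by (simp add: dual_iff dual_op_def case_prod_unfold mult.commute)
qed

lemma contract_left:
  obtains y where "\<And>g. g \<in> dual scale \<Longrightarrow> g y = dual_op \<delta> h g x"
proof
  fix g assume g: "g \<in> dual scale"
  then have "g (lext scale (\<lambda>z. scale (h (fst z)) (snd z)) (\<delta> x)) =
      lext (*) (\<lambda>z. g (scale (h (fst z)) (snd z))) (\<delta> x)"
    unfolding dual_def by (intro linear_of_lext) simp
  then show "g (lext scale (\<lambda>z. scale (h (fst z)) (snd z)) (\<delta> x)) = dual_op \<delta> h g x"
    using g by (simp add: dual_iff dual_op_def case_prod_unfold)
qed

lemma dual_eval_append:
  assumes "set fs \<subseteq> dual scale" "set gs \<subseteq> dual scale" "length fs = arity c" "length gs = arity d"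
  shows "dual_eval (dup_lt c d) (fs @ gs) = dual_op dlt (dual_eval c fs) (dual_eval d gs)"
    "dual_eval (dup_gt c d) (fs @ gs) = dual_op dgt (dual_eval c fs) (dual_eval d gs)"
  using assms by (simp_all add: dual.dup_eval_lt_append dual.dup_eval_gt_append)

text \<open>Fixing a single arity gives a condition that passes to contractions of \<open>x\<close>,
  with the arity lowered by the inputs of the contracted operation.\<close>

definition killed_in_arity :: "nat \<Rightarrow> 'h set" where
  "killed_in_arity n = {x. \<forall>c fs. arity c = n \<longrightarrow> set fs \<subseteq> dual scale \<longrightarrow> length fs = n \<longrightarrow> dual_eval c fs x = 0}"

lemma killed_in_arityD:
  "x \<in> killed_in_arity n \<Longrightarrow> arity c = n \<Longrightarrow> set fs \<subseteq> dual scale \<Longrightarrow> length fs = n \<Longrightarrow> dual_eval c fs x = 0"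
  by (simp add: killed_in_arity_def)

text \<open>If all operations of arity \<open>arity c + 1\<close> kill \<open>x\<close>, then the value of the iterated cooperation
  \<open>c\<close> on \<open>x\<close> is a tensor of primitive elements, here expressed by pairing it with functionals. Freezing
  all but one factor of an operation reduces this to the definition of primitive elements.\<close>

lemma dual_eval_killed:
  assumes "x \<in> killed_in_arity (Suc (arity c))" "set fs \<subseteq> dual scale" "length fs = arity c"
    "f \<in> set fs" "\<And>v. v \<in> prim scale dlt dgt \<Longrightarrow> f v = 0"
  shows "dual_eval c fs x = 0"
  using assms(1-4)
proof (induction c arbitrary: fs x rule: dup_induct)
  case id
  \<comment> \<open>The operations of arity 2 are the two generating products, so an element killed
    by them is primitive.\<close>
  have "dual_op dlt g h x = 0 \<and> dual_op dgt g h x = 0" if "g \<in> dual scale" "h \<in> dual scale" for g h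
    using dual_eval_append[of "[g]" "[h]" dup_id dup_id] that
      killed_in_arityD[OF id.prems(1), of "dup_lt dup_id dup_id" "[g, h]"]
      killed_in_arityD[OF id.prems(1), of "dup_gt dup_id dup_id" "[g, h]"]
    by (simp add: dual.dup_eval_id)
  then have "x \<in> prim scale dlt dgt" by (simp add: prim_iff)
  moreover have "fs = [f]" using id.prems(3,4) by (auto simp: length_Suc_conv)
  ultimately show ?case using id.prems(2) assms(5) by (simp add: dual.dup_eval_id)
next
  case (lt d e)
  let ?fs = "take (arity d) fs" and ?gs = "drop (arity d) fs"
  have fs: "set ?fs \<subseteq> dual scale" "set ?gs \<subseteq> dual scale" "length ?fs = arity d" "length ?gs = arity e"
    using lt.prems dual.set_take_drop by auto
  have eq: "dual_eval (dup_lt d e) fs x = dual_op dlt (dual_eval d ?fs) (dual_eval e ?gs) x"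
    using dual_eval_append(1)[OF fs] by simp
  have "f \<in> set ?fs \<or> f \<in> set ?gs" using lt.prems(4) by (metis Un_iff append_take_drop_id set_append)
  then show ?case
  proof
    assume f: "f \<in> set ?fs"
    obtain y where y: "\<And>g. g \<in> dual scale \<Longrightarrow> g y = dual_op dlt g (dual_eval e ?gs) x"
      by (rule contract_right[where \<delta>=dlt and h="dual_eval e ?gs" and x=x]) blast
    \<comment> \<open>Applying \<open>c\<close> to \<open>y\<close> amounts to applying
      \<open>dup_lt c e\<close> to \<open>x\<close>, and the arity of \<open>dup_lt c e\<close>
      exceeds that of \<open>dup_lt d e\<close> by one.\<close>
    have "y \<in> killed_in_arity (Suc (arity d))"
      unfolding killed_in_arity_def
    proof (rule CollectI, intro allI impI)
      fix c gs assume "arity c = Suc (arity d)" "set gs \<subseteq> dual scale" "length gs = Suc (arity d)"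
      then show "dual_eval c gs y = 0"
        using killed_in_arityD[OF lt.prems(1), of "dup_lt c e" "gs @ ?gs"] dual_eval_append(1)[of gs ?gs c e] fs
        by (simp add: y dual_eval_dual)
    qed
    from lt.IH(1)[OF this fs(1,3) f] show ?thesis
      unfolding eq y[OF dual_eval_dual[OF fs(1,3)]] .
  next
    assume f: "f \<in> set ?gs"
    obtain y where y: "\<And>g. g \<in> dual scale \<Longrightarrow> g y = dual_op dlt (dual_eval d ?fs) g x"
      by (rule contract_left[where \<delta>=dlt and h="dual_eval d ?fs" and x=x]) blast
    have "y \<in> killed_in_arity (Suc (arity e))"
      unfolding killed_in_arity_def
    proof (rule CollectI, intro allI impI)
      fix c gs assume "arity c = Suc (arity e)" "set gs \<subseteq> dual scale" "length gs = Suc (arity e)"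
      then show "dual_eval c gs y = 0"
        using killed_in_arityD[OF lt.prems(1), of "dup_lt d c" "?fs @ gs"] dual_eval_append(1)[of ?fs gs d c] fs
        by (simp add: y dual_eval_dual)
    qed
    from lt.IH(2)[OF this fs(2,4) f] show ?thesis
      unfolding eq y[OF dual_eval_dual[OF fs(2,4)]] .
  qed
next
  case (gt d e)
  let ?fs = "take (arity d) fs" and ?gs = "drop (arity d) fs"
  have fs: "set ?fs \<subseteq> dual scale" "set ?gs \<subseteq> dual scale" "length ?fs = arity d" "length ?gs = arity e"
    using gt.prems dual.set_take_drop by auto
  have eq: "dual_eval (dup_gt d e) fs x = dual_op dgt (dual_eval d ?fs) (dual_eval e ?gs) x"
    using dual_eval_append(2)[OF fs] by simp
  have "f \<in> set ?fs \<or> f \<in> set ?gs" using gt.prems(4) by (metis Un_iff append_take_drop_id set_append)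
  then show ?case
  proof
    assume f: "f \<in> set ?fs"
    obtain y where y: "\<And>g. g \<in> dual scale \<Longrightarrow> g y = dual_op dgt g (dual_eval e ?gs) x"
      by (rule contract_right[where \<delta>=dgt and h="dual_eval e ?gs" and x=x]) blast
    have "y \<in> killed_in_arity (Suc (arity d))"
      unfolding killed_in_arity_def
    proof (rule CollectI, intro allI impI)
      fix c gs assume "arity c = Suc (arity d)" "set gs \<subseteq> dual scale" "length gs = Suc (arity d)"
      then show "dual_eval c gs y = 0"
        using killed_in_arityD[OF gt.prems(1), of "dup_gt c e" "gs @ ?gs"] dual_eval_append(2)[of gs ?gs c e] fs
        by (simp add: y dual_eval_dual)
    qed
    from gt.IH(1)[OF this fs(1,3) f] show ?thesis
      unfolding eq y[OF dual_eval_dual[OF fs(1,3)]] .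
  next
    assume f: "f \<in> set ?gs"
    obtain y where y: "\<And>g. g \<in> dual scale \<Longrightarrow> g y = dual_op dgt (dual_eval d ?fs) g x"
      by (rule contract_left[where \<delta>=dgt and h="dual_eval d ?fs" and x=x]) blast
    have "y \<in> killed_in_arity (Suc (arity e))"
      unfolding killed_in_arity_def
    proof (rule CollectI, intro allI impI)
      fix c gs assume "arity c = Suc (arity e)" "set gs \<subseteq> dual scale" "length gs = Suc (arity e)"
      then show "dual_eval c gs y = 0"
        using killed_in_arityD[OF gt.prems(1), of "dup_gt d c" "?fs @ gs"] dual_eval_append(2)[of ?fs gs d c] fs
        by (simp add: y dual_eval_dual)
    qed
    from gt.IH(2)[OF this fs(2,4) f] show ?thesis
      unfolding eq y[OF dual_eval_dual[OF fs(2,4)]] .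
  qed
qed

text \<open>The iterated cooperation is expanded over the whole space, in a basis adapted to the
  primitives. A nonprimitive basis vector has a coordinate functional that vanishes on primitives,
  so by \<open>dual_eval_killed\<close> no word containing it occurs.\<close>

lemma iterated_cop_primitive:
  assumes "x \<in> killed_in_arity (Suc (arity c))"
  obtains q where "\<And>w. w \<in> Poly_Mapping.keys q \<Longrightarrow> length w = arity c \<and> set w \<subseteq> prim scale dlt dgt"
    "\<And>fs. set fs \<subseteq> dual scale \<Longrightarrow> length fs = arity c \<Longrightarrow> lext (*) (tens fs) q = dual_eval c fs x"
proof -
  let ?V = "prim scale dlt dgt" and ?q = "iter_cop dlt dgt (rep_dup c) x"
  obtain B where B: "independent B" "span B = UNIV" "span (B \<inter> ?V) = ?V"
    using adapted_basis[OF subspace_prim] .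
  have B': "span (B \<inter> UNIV) = UNIV" using B by simp
  have q: "length w = arity c \<and> set w \<subseteq> UNIV" if "w \<in> Poly_Mapping.keys ?q" for w
    using keys_iter_cop[OF that] by (simp add: inputs_rep_dup)
  have tens_q: "lext (*) (tens fs) ?q = dual_eval c fs x"
    if "set fs \<subseteq> dual scale" "length fs = arity c" for fs
    using tens_iter_cop_dual_eval[of fs "rep_dup c" x] that by (simp add: inputs_rep_dup abs_rep_dup)
  obtain p where p: "?q - p \<in> formal.span (tensor_rels scale UNIV (arity c))"
    "\<And>\<beta>. \<beta> \<in> Poly_Mapping.keys p \<Longrightarrow> length \<beta> = arity c \<and> set \<beta> \<subseteq> B \<inter> UNIV \<and>
      lext (*) (tens (map (\<lambda>b v. representation B v b) \<beta>)) ?q \<noteq> 0"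
    using tensor_expansion[OF B(1,2) B' q] by blast
  show thesis
  proof
    fix \<beta> assume "\<beta> \<in> Poly_Mapping.keys p"
    note \<beta> = p(2)[OF this]
    let ?fs = "map (\<lambda>b v. representation B v b) \<beta>"
    have fs: "set ?fs \<subseteq> dual scale" "length ?fs = arity c"
      using \<beta> representation_dual[OF B(1,2)] by auto
    have "b \<in> ?V" if b: "b \<in> set \<beta>" for b
    proof (rule ccontr)
      assume "b \<notin> ?V"
      then have "representation B v b = 0" if "v \<in> ?V" for v
        using representation_adapted[OF B(1,3) that] representation_ne_zero[of "B \<inter> ?V" v b] by auto
      then have "dual_eval c ?fs x = 0"
        using b by (intro dual_eval_killed[OF assms fs, of "\<lambda>v. representation B v b"]) auto
      then show False using \<beta> tens_q[OF fs] by simp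
    qed
    then show "length \<beta> = arity c \<and> set \<beta> \<subseteq> ?V" using \<beta> by auto
  next
    fix fs assume fs: "set fs \<subseteq> dual scale" "length fs = arity c"
    show "lext (*) (tens fs) p = dual_eval c fs x"
      using tens_span_tensor_rels[OF p(1) fs] tens_q[OF fs] by (simp add: field.lext_diff)
  qed
qed

lemma filt_killed: "x \<in> filt scale dlt dgt r \<longleftrightarrow> (\<forall>n>r. x \<in> killed_in_arity n)"
  unfolding filt_iff killed_in_arity_def by auto

end

section \<open>Peeling off the top arity, and the equivalence of (a), (b), (c)\<close>

context inf_bidup_bialgebra
begin

interpretation realize: Vector_Spaces.linear fscale scale realize
  by (rule linear_realize)

lemma filt_realized: "x \<in> filt scale dlt dgt r \<Longrightarrow> \<exists>p\<in>dup_space primitives. realize p = x"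
proof (induction r arbitrary: x)
  case 0
  \<comment> \<open>The identity operation has arity 1, so every functional kills the elements of
    the bottom filtration step, which is therefore zero.\<close>
  have "f x = 0" if "f \<in> dual scale" for f
    using 0[unfolded filt_iff, rule_format, of dup_id "[f]"] that by (simp add: dual.dup_eval_id)
  moreover obtain B where B: "independent B" "span B = UNIV"
    using adapted_basis[OF subspace_UNIV] by metis
  ultimately have "representation B x b = 0" for b
    using representation_dual[OF B] by metis
  then have "x = 0" using sum_nonzero_representation_eq[OF B(1), of x] B(2) by simp
  then show ?case by (intro bexI[of _ 0]) (auto simp: dup_space_def realize.zero)
next
  case (Suc r)
  let ?C = "{c. arity c = Suc r}"
  have C: "finite ?C" by (rule finite_subset[OF _ finite_arity_le[of "Suc r"]]) auto
  have "\<forall>c\<in>?C. \<exists>q. (\<forall>w\<in>Poly_Mapping.keys q. length w = arity c \<and> set w \<subseteq> primitives) \<and>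
      (\<forall>fs. set fs \<subseteq> dual scale \<longrightarrow> length fs = arity c \<longrightarrow> lext (*) (tens fs) q = dual_eval c fs x)"
  proof
    fix c assume "c \<in> ?C"
    then have "x \<in> killed_in_arity (Suc (arity c))" using Suc.prems by (simp add: filt_killed)
    then show "\<exists>q. (\<forall>w\<in>Poly_Mapping.keys q. length w = arity c \<and> set w \<subseteq> primitives) \<and>
      (\<forall>fs. set fs \<subseteq> dual scale \<longrightarrow> length fs = arity c \<longrightarrow> lext (*) (tens fs) q = dual_eval c fs x)"
      by (rule iterated_cop_primitive) blast
  qed
  then obtain q where q: "\<And>c w. c \<in> ?C \<Longrightarrow> w \<in> Poly_Mapping.keys (q c) \<Longrightarrow> length w = arity c \<and> set w \<subseteq> primitives"
    "\<And>c fs. c \<in> ?C \<Longrightarrow> set fs \<subseteq> dual scale \<Longrightarrow> length fs = arity c \<Longrightarrow> lext (*) (tens fs) (q c) = dual_eval c fs x"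
    unfolding bchoice_iff by blast
  \<comment> \<open>The tensors \<open>q c\<close> prescribe the iterated cooperations of top arity;
    the sum is finite because each arity has finitely many operations.\<close>
  define p where "p = (\<Sum>c\<in>?C. tag c (q c))"
  have p: "p \<in> dup_space primitives"
    unfolding p_def by (intro dup_space_sum tag_in_dup_space q(1))
  have "x - realize p \<in> filt scale dlt dgt r"
    unfolding filt_iff
  proof (intro allI impI)
    fix d fs assume d: "r < arity d" and fs: "set fs \<subseteq> dual scale" "length fs = arity d"
    have "Vector_Spaces.linear scale (*) (dual_eval d fs)"
      using dual_eval_dual[OF fs] by (simp add: dual_def)
    then interpret D: Vector_Spaces.linear scale "(*)" "dual_eval d fs" .
    have "dual_eval d fs (realize p) = (\<Sum>c\<in>?C. dual_eval d fs (realize (tag c (q c))))"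
      by (simp add: p_def realize.sum D.sum)
    also have "\<dots> = (\<Sum>c\<in>?C. if c = d then dual_eval d fs x else 0)"
    proof (rule sum.cong[OF HOL.refl])
      fix c assume c: "c \<in> ?C"
      then have "arity c \<le> arity d" using d by simp
      then show "dual_eval d fs (realize (tag c (q c))) = (if c = d then dual_eval d fs x else 0)"
        using dual_eval_realize_tag[OF q(1)[OF c] fs] q(2)[OF c fs(1)] fs(2) by auto
    qed
    also have "\<dots> = dual_eval d fs x"
    proof (cases "d \<in> ?C")
      case True
      then show ?thesis using C by simp
    next
      case False
      \<comment> \<open>Here \<open>d\<close> has arity above \<open>Suc r\<close>: no summand
        matches it, and \<open>x\<close> is killed as well.\<close>
      then have "dual_eval d fs x = 0" using Suc.prems d fs by (auto simp: filt_iff)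
      then show ?thesis by (simp cong: if_cong)
    qed
    finally show "dual_eval d fs (x - realize p) = 0" by (simp add: D.diff)
  qed
  then obtain p' where p': "p' \<in> dup_space primitives" "realize p' = x - realize p"
    using Suc.IH by blast
  have "p + p' \<in> dup_space primitives"
    using p p'(1) Poly_Mapping.keys_add[of p p'] unfolding dup_space_def by blast
  moreover have "realize (p + p') = x" by (simp add: realize.add p'(2))
  ultimately show ?case by blast
qed

lemma realize_iso:
  assumes "connected_coalgebra scale dlt dgt"
  shows "linear_iso_from_dup scale primitives realize"
  unfolding linear_iso_from_dup_def
proof (intro conjI ballI)
  fix p q :: "('h, 'k) dup_comb" assume "p \<in> dup_space primitives" "q \<in> dup_space primitives"
  then show "realize p = realize q \<longleftrightarrow> p - q \<in> dup_null scale primitives"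
    using realize_eq_0_iff[OF dup_space_diff] by (simp add: realize.diff)
next
  have "x \<in> realize ` dup_space primitives" for x
  proof -
    have "x \<in> (\<Union>r. filt scale dlt dgt r)"
      using assms unfolding connected_coalgebra_def by simp
    then obtain r where "x \<in> filt scale dlt dgt r" ..
    from filt_realized[OF this] show ?thesis by blast
  qed
  then show "realize ` dup_space primitives = UNIV" by blast
qed (rule linear_realize)

lemma connected_iff_iso_free:
  "connected_coalgebra scale dlt dgt \<longleftrightarrow> iso_free_bialgebra scale lt gt dlt dgt primitives"
  unfolding iso_free_bialgebra_def
  using realize_iso realize_preserves_product realize_preserves_cop connected_of_preserves_cop by blast

text \<open>The canonical map serves again, because the free and cofree cooperations are
  equal.\<close>

lemma connected_iff_iso_cofree:
  "connected_coalgebra scale dlt dgt \<longleftrightarrow> iso_cofree_coalgebra scale dlt dgt primitives"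
  unfolding iso_cofree_coalgebra_def cop_lt_eq_cofree[symmetric] cop_gt_eq_cofree[symmetric]
  using realize_iso realize_preserves_cop connected_of_preserves_cop by blast

end

section \<open>The primitive operad\<close>

definition coord :: "'x \<Rightarrow> ('x \<Rightarrow>\<^sub>0 'k::field) \<Rightarrow> 'k" where
  "coord x v = Poly_Mapping.lookup v x"

lemma coord_dual: "coord x \<in> dual fscale"
  by (simp add: formal.dual_iff coord_def lookup_add)

lemma tens_coord_gen:
  "length \<sigma> = length w \<Longrightarrow> tens (map coord \<sigma>) (map gen w) = (if \<sigma> = w then 1 else (0::'k::field))"
  by (induction rule: list_induct2) (auto simp: coord_def lookup_single when_def)

text \<open>The coordinate functional of the basis element \<open>(c, \<sigma>)\<close> of the free
  algebra on variables, with \<open>\<sigma>\<close> listing variables.\<close>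

definition dup_coord :: "dup \<Rightarrow> 'x list \<Rightarrow> dup \<times> ('x \<Rightarrow>\<^sub>0 'k::field) list \<Rightarrow> 'k" where
  "dup_coord c \<sigma> = (\<lambda>(d, w). if d = c then tens (map coord \<sigma>) w else 0)"

text \<open>Products of coordinates are multilinear, so they pass to the quotient; coefficients
  therefore remain visible modulo null combinations.\<close>

lemma dup_coord_null:
  assumes "p \<in> dup_null fscale V" "length \<sigma> = arity c"
  shows "lext (*) (dup_coord c \<sigma>) p = 0"
proof -
  have rels: "lext (*) (dup_coord c \<sigma>) (flin (\<lambda>w. gen (d, w)) r) = 0"
    if "r \<in> tensor_rels fscale V (arity d)" for d r
  proof -
    have "lext (*) (dup_coord c \<sigma>) (flin (\<lambda>w. gen (d, w)) r) =
        lext (*) (\<lambda>w. if d = c then tens (map coord \<sigma>) w else 0) r"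
      by (simp add: field.lext_flin field.lext_gen dup_coord_def)
    also have "\<dots> = 0"
      using formal.tens_tensor_rels[OF that, of "map coord \<sigma>"] assms(2)
      by (cases "d = c") (auto simp: field.lext_eq_0 coord_dual image_subset_iff)
    finally show ?thesis .
  qed
  from assms(1) show ?thesis unfolding dup_null_def
    by (induction rule: formal.span_induct_alt)
      (auto simp: rels field.lext_zero field.lext_add field.lext_fscale)
qed

lemma lext_pair_prod:
  "lext (*) (\<lambda>(x, y). \<phi> x * \<psi> y) (pair_prod p q) = lext (*) \<phi> p * lext (*) \<psi> q"
  by (simp add: pair_prod_def field.lext_flin field.lext_gen lext_mult mult_lext[symmetric])

lemma dup_coord_square_null:
  assumes "r \<in> dup_square_null fscale V" "length \<sigma> = arity a" "length \<tau> = arity b"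
  shows "lext (*) (\<lambda>(x, y). dup_coord a \<sigma> x * dup_coord b \<tau> y) r = 0"
  using assms(1) unfolding dup_square_null_def
  by (induction rule: formal.span_induct_alt)
    (auto simp: field.lext_zero field.lext_add field.lext_fscale lext_pair_prod
      dup_coord_null[OF _ assms(2)] dup_coord_null[OF _ assms(3)])

lemma dup_operad_keys:
  assumes "\<mu> \<in> dup_operad n" "(c, w) \<in> Poly_Mapping.keys \<mu>"
  shows "arity c = n" "mset w = mset [0..<n]" "length w = n"
proof -
  show *: "arity c = n" "mset w = mset [0..<n]" using assms unfolding dup_operad_def by blast+
  show "length w = n" using mset_eq_length[OF *(2)] by simp
qed

text \<open>The coefficient of \<open>(m a b, \<sigma>)\<close> is read off the cooperation dual to \<open>m\<close>, because \<open>m a b\<close> is the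
  only operation that this cooperation cuts into \<open>a\<close> and \<open>b\<close>.\<close>

lemma coefficient_of_word_cop:
  fixes \<mu> :: "(nat, 'k::field) dup_comb"
  assumes \<mu>: "\<mu> \<in> dup_operad n"
    and cop: "\<And>c (F :: dup \<times> dup \<Rightarrow> 'k). (\<Sum>x\<in>#cop c. F x) = (\<Sum>x | m (fst x) (snd x) = c. F x)"
    and fin: "\<And>c. finite {x. m (fst x) (snd x) = c}"
    and ar: "arity (m a b) = arity a + arity b"
    and null: "word_cop cop (apply_operation \<mu> gen) \<in> dup_square_null fscale V"
    and \<sigma>: "length \<sigma> = arity a + arity b"
  shows "Poly_Mapping.lookup \<mu> (m a b, \<sigma>) = 0"
proof -
  let ?\<sigma> = "take (arity a) \<sigma>" and ?\<tau> = "drop (arity a) \<sigma>"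
  let ?F = "\<lambda>w x. dup_coord a ?\<sigma> (fst x, take (arity (fst x)) (map gen w)) *
      dup_coord b ?\<tau> (snd x, drop (arity (fst x)) (map gen w)) :: 'k"
  have inner: "(\<Sum>x\<in>#cop c. ?F w x) = (if (c, w) = (m a b, \<sigma>) then 1 else 0)"
    if cw: "(c, w) \<in> Poly_Mapping.keys \<mu>" for c w
  proof -
    have len: "length w = arity c"
      using dup_operad_keys[OF \<mu> cw] by simp
    \<comment> \<open>The coordinate functionals vanish off the operations \<open>a\<close> and
      \<open>b\<close>, which leaves a single cut.\<close>
    have "(\<Sum>x\<in>#cop c. ?F w x) = (\<Sum>x | m (fst x) (snd x) = c. if x = (a, b) then ?F w (a, b) else 0)"
      unfolding cop by (intro sum.cong) (auto simp: dup_coord_def)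
    also have "\<dots> = (if m a b = c then ?F w (a, b) else 0)"
      using fin[of c] by simp
    also have "\<dots> = (if (c, w) = (m a b, \<sigma>) then 1 else 0)"
    proof (cases "m a b = c")
      case True
      then have "length \<sigma> = length w" using len ar \<sigma> by simp
      have "?F w (a, b) = tens (map coord \<sigma>) (map gen w)"
        using tens_split[of "map coord \<sigma>" "map gen w" "arity a", symmetric] \<open>length \<sigma> = length w\<close>
        by (simp add: dup_coord_def take_map drop_map)
      also have "\<dots> = (if \<sigma> = w then 1 else 0)"
        by (rule tens_coord_gen) fact
      finally show ?thesis using True by auto
    qed auto
    finally show ?thesis .
  qed
  have "0 = lext (*) (\<lambda>(x, y). dup_coord a ?\<sigma> x * dup_coord b ?\<tau> y) (word_cop cop (apply_operation \<mu> gen))"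
    using dup_coord_square_null[OF null] \<sigma> by simp
  also have "\<dots> = lext (*) (\<lambda>(c, w). \<Sum>x\<in>#cop c. ?F w x) \<mu>"
    by (simp add: word_cop_def apply_operation_def field.lext_flin field.lext_gen case_prod_unfold
        field.lext_sum_mset)
  also have "\<dots> = lext (*) (\<lambda>x. if x = (m a b, \<sigma>) then 1 else 0) \<mu>"
    using inner by (intro field.lext_cong) (auto split: if_splits)
  also have "\<dots> = Poly_Mapping.lookup \<mu> (m a b, \<sigma>)"
    by (simp add: lext_def in_keys_iff if_distrib cong: if_cong)
  finally show ?thesis by simp
qed

text \<open>Every operation except the identity is a product, and the cooperation matching its outer
  product would detect its coefficient.\<close>

lemma prim_operad_keys:
  assumes "\<mu> \<in> prim_operad n" "(c, w) \<in> Poly_Mapping.keys \<mu>"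
  shows "n = 1" "c = dup_id" "w = [0]"
proof -
  have \<mu>: "\<mu> \<in> dup_operad n"
    and null: "word_cop cop_lt (apply_operation \<mu> gen) \<in> dup_square_null fscale (span_vars n)"
      "word_cop cop_gt (apply_operation \<mu> gen) \<in> dup_square_null fscale (span_vars n)"
    using assms(1) by (auto simp: prim_operad_def dup_prim_def)
  note n = dup_operad_keys(1)[OF \<mu> assms(2)] and w = dup_operad_keys(2)[OF \<mu> assms(2)]
  have len: "length w = arity c" using dup_operad_keys[OF \<mu> assms(2)] by simp
  have nz: "Poly_Mapping.lookup \<mu> (c, w) \<noteq> 0" using assms(2) by (simp add: in_keys_iff)
  show c: "c = dup_id"
  proof (cases c rule: dup_cases)
    case (lt a b)
    then show ?thesis
      using coefficient_of_word_cop[OF \<mu> sum_cop_lt _ _ null(1), of a b w] nz len finite_decompositions(1)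
      by (simp add: case_prod_unfold)
  next
    case (gt a b)
    then show ?thesis
      using coefficient_of_word_cop[OF \<mu> sum_cop_gt _ _ null(2), of a b w] nz len finite_decompositions(2)
      by (simp add: case_prod_unfold)
  qed
  show "n = 1" using n c by simp
  then show "w = [0]" using w by simp
qed

lemma prim_operad_eq_vect: "(prim_operad n :: (nat, 'k::field) dup_comb set) = vect_operad n"
proof
  show "(prim_operad n :: (nat, 'k) dup_comb set) \<subseteq> vect_operad n"
  proof
    fix \<mu> :: "(nat, 'k) dup_comb" assume \<mu>: "\<mu> \<in> prim_operad n"
    show "\<mu> \<in> vect_operad n"
    proof (cases "n = 1")
      case True
      have "Poly_Mapping.lookup \<mu> x = 0" if "x \<noteq> (dup_id, [0])" for x
        using prim_operad_keys[OF \<mu>, of "fst x" "snd x"] that by (cases x) (auto simp: in_keys_iff)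
      then have "\<mu> = fscale (Poly_Mapping.lookup \<mu> (dup_id, [0])) (gen (dup_id, [0]))"
        by (intro poly_mapping_eqI) (auto simp: lookup_single when_def)
      then show ?thesis using True by (auto simp: vect_operad_def)
    next
      case False
      have "Poly_Mapping.lookup \<mu> x = 0" for x
        using prim_operad_keys(1)[OF \<mu>, of "fst x" "snd x"] False by (auto simp: in_keys_iff)
      then have "\<mu> = 0" by (intro poly_mapping_eqI) simp
      then show ?thesis using False by (simp add: vect_operad_def)
    qed
  qed
  show "(vect_operad n :: (nat, 'k) dup_comb set) \<subseteq> prim_operad n"
  proof
    fix \<mu> :: "(nat, 'k) dup_comb" assume "\<mu> \<in> vect_operad n"
    \<comment> \<open>The zero operation is also written as a multiple of the identity, with
      \<open>k = 0\<close>, so that all arities are treated at once.\<close>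
    then obtain k where \<mu>: "\<mu> = fscale k (gen (dup_id, [0]))" "n = 1 \<or> k = 0"
      by (auto simp: vect_operad_def split: if_splits)
    let ?p = "apply_operation \<mu> gen :: (nat \<Rightarrow>\<^sub>0 'k, 'k) dup_comb"
    have op: "?p = fscale k (gen (dup_id, [gen 0]))"
      by (simp add: apply_operation_def \<mu>(1) flin_eq_lext formal.lext_fscale formal.lext_gen)
    have "word_cop cop_lt (?p) = 0" "word_cop cop_gt (?p) = 0"
      by (simp_all add: word_cop_def op flin_eq_lext formal.lext_fscale formal.lext_gen
          cop_lt_simps cop_gt_simps)
    moreover have "?p \<in> dup_space (span_vars n)"
      using \<mu>(2) by (auto simp: op dup_space_def span_vars_def in_keys_iff lookup_single lookup_one when_def split: if_splits)
    moreover have "\<mu> \<in> dup_operad n"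
      using \<mu>(2) by (auto simp: \<mu>(1) dup_operad_def in_keys_iff lookup_single lookup_one when_def split: if_splits)
    moreover have "0 \<in> dup_square_null fscale (span_vars n :: (nat \<Rightarrow>\<^sub>0 'k) set)"
      unfolding dup_square_null_def by (rule formal.span_zero)
    ultimately show "\<mu> \<in> prim_operad n"
      by (simp add: prim_operad_def dup_prim_def)
  qed
qed

theorem corollary5p7p4:
  fixes scale :: "'k::field \<Rightarrow> 'h::ab_group_add \<Rightarrow> 'h"
  assumes "inf_bidup_bialgebra scale lt gt dlt dgt"
  shows "(\<forall>n. (prim_operad n :: (nat, 'k) dup_comb set) = vect_operad n) \<and>
    (connected_coalgebra scale dlt dgt \<longleftrightarrow>
       iso_free_bialgebra scale lt gt dlt dgt (prim scale dlt dgt)) \<and>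
    (connected_coalgebra scale dlt dgt \<longleftrightarrow>
       iso_cofree_coalgebra scale dlt dgt (prim scale dlt dgt))"
proof -
  interpret inf_bidup_bialgebra scale lt gt dlt dgt by fact
  show ?thesis using prim_operad_eq_vect connected_iff_iso_free connected_iff_iso_cofree by blast
qed

end
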